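(* Let $\alpha<1$ and $1\le p\le\infty$. For $f\in L^p(0,1)$ let $u_N=u_{N,f}$ denote the unique function in $W^{2,p}_{loc}((0,1])$ satisfying $-(x^{2\alpha}u_N'(x))'+u_N(x)=f(x)$ for a.e. $x\in(0,1]$, $u_N(1)=0$ and $\lim_{x\to0^+}x^{2\alpha}u_N'(x)=0$. Define, for $x\in(0,1)$, $$K_N(x):=\sup_{\|f\|_{L^p}\le1}\left|x^{2\alpha-1+\frac1p}u_{N,f}'(x)\right|.$$ Then there exist $\varepsilon_0>0$ and constants $0<C_1<C_2$ such that $C_1\le K_N(x)\le C_2$ for all $0<x\le\varepsilon_0$.
   Context: All functions are real valued. $W^{2,p}_{loc}((0,1])$ is the set of functions on $(0,1]$ belonging to $W^{2,p}(\delta,1)$ for every $\delta\in(0,1)$. Such a solution $u_{N,f}$ exists and is unique for every $f\in L^p(0,1)$. The convention $\frac1p=0$ is used when $p=\infty$. The supremum is over $f\in L^p(0,1)$; the constants $\varepsilon_0,C_1,C_2$ may depend on $\alpha$ and $p$. *)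

theory Defs
  imports "HOL-Analysis.Analysis" "HOL-Probability.Essential_Supremum"
begin

definition Lp_space :: "ereal \<Rightarrow> real set \<Rightarrow> (real \<Rightarrow> real) set" where
  "Lp_space p S = {f \<in> borel_measurable (lebesgue_on S).
     if p = \<infinity> then esssup (lebesgue_on S) (\<lambda>x. ereal \<bar>f x\<bar>) < \<infinity>
     else integrable (lebesgue_on S) (\<lambda>x. \<bar>f x\<bar> powr real_of_ereal p)}"

definition Lp_norm :: "ereal \<Rightarrow> real set \<Rightarrow> (real \<Rightarrow> real) \<Rightarrow> real" where
  "Lp_norm p S f =
     (if p = \<infinity> then real_of_ereal (esssup (lebesgue_on S) (\<lambda>x. ereal \<bar>f x\<bar>))
      else (LINT x|lebesgue_on S. \<bar>f x\<bar> powr real_of_ereal p) powr (1 / real_of_ereal p))"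

text \<open>Test functions are taken in the class \<open>C\<^sub>c\<^sup>1\<close>, as in Brezis' textbook; on an interval this
  gives the same weak derivatives as infinitely differentiable test functions.\<close>

definition test_function :: "real \<Rightarrow> real \<Rightarrow> (real \<Rightarrow> real) \<Rightarrow> bool" where
  "test_function a b \<phi> \<longleftrightarrow> \<phi> C1_differentiable_on UNIV \<and>
     compact (closure {x. \<phi> x \<noteq> 0}) \<and> closure {x. \<phi> x \<noteq> 0} \<subseteq> {a<..<b}"

definition locally_integrable :: "real \<Rightarrow> real \<Rightarrow> (real \<Rightarrow> real) \<Rightarrow> bool" where
  "locally_integrable a b u \<longleftrightarrow>
     (\<forall>c d. a < c \<longrightarrow> c < d \<longrightarrow> d < b \<longrightarrow> u absolutely_integrable_on {c..d})"

definition has_weak_deriv :: "real \<Rightarrow> real \<Rightarrow> (real \<Rightarrow> real) \<Rightarrow> (real \<Rightarrow> real) \<Rightarrow> bool" where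
  "has_weak_deriv a b u g \<longleftrightarrow> locally_integrable a b u \<and> locally_integrable a b g \<and>
     (\<forall>\<phi>. test_function a b \<phi> \<longrightarrow>
        (LINT x|lebesgue_on {a<..<b}. u x * deriv \<phi> x) = - (LINT x|lebesgue_on {a<..<b}. g x * \<phi> x))"

definition W1p :: "ereal \<Rightarrow> real \<Rightarrow> real \<Rightarrow> (real \<Rightarrow> real) set" where
  "W1p p a b = {u \<in> Lp_space p {a<..<b}.
     \<exists>g \<in> Lp_space p {a<..<b}. has_weak_deriv a b u g}"

definition W2p :: "ereal \<Rightarrow> real \<Rightarrow> real \<Rightarrow> (real \<Rightarrow> real) set" where
  "W2p p a b = {u \<in> Lp_space p {a<..<b}. \<exists>g \<in> W1p p a b. has_weak_deriv a b u g}"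

definition W2p_loc :: "ereal \<Rightarrow> (real \<Rightarrow> real) set" where
  "W2p_loc p = {u. \<forall>\<delta>\<in>{0<..<1}. u \<in> W2p p \<delta> 1}"

text \<open>An element of \<open>W\<^sup>2\<^sup>,\<^sup>p\<close> is identified with its continuous representative on \<open>(0,1]\<close>, which is
  automatically continuously differentiable, so that \<^const>\<open>deriv\<close> is its classical derivative;
  \<^const>\<open>extensional\<close> only normalises the irrelevant values outside \<open>(0,1]\<close>.
  The outer derivative in the equation is the weak one.\<close>

definition neumann_solution :: "real \<Rightarrow> ereal \<Rightarrow> (real \<Rightarrow> real) \<Rightarrow> (real \<Rightarrow> real) \<Rightarrow> bool" where
  "neumann_solution \<alpha> p f u \<longleftrightarrow>
     u \<in> extensional {0<..1} \<and> continuous_on {0<..1} u \<and> u \<in> W2p_loc p \<and>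
     (\<exists>v. has_weak_deriv 0 1 (\<lambda>x. x powr (2 * \<alpha>) * deriv u x) v \<and>
          (AE x in lebesgue_on {0<..1}. - v x + u x = f x)) \<and>
     u 1 = 0 \<and>
     ((\<lambda>x. x powr (2 * \<alpha>) * deriv u x) \<longlongrightarrow> 0) (at_right 0)"

definition u_N :: "real \<Rightarrow> ereal \<Rightarrow> (real \<Rightarrow> real) \<Rightarrow> real \<Rightarrow> real" where
  "u_N \<alpha> p f = (THE u. neumann_solution \<alpha> p f u)"

text \<open>The supremum is taken in the extended reals, so that its finiteness is part of any upper
  bound; \<open>1 / p = 0\<close> holds for \<open>p = \<infinity>\<close> in \<^typ>\<open>ereal\<close>.\<close>

definition K_N :: "real \<Rightarrow> ereal \<Rightarrow> real \<Rightarrow> ereal" where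
  "K_N \<alpha> p x =
     (SUP f \<in> {f \<in> Lp_space p {0<..<1}. Lp_norm p {0<..<1} f \<le> 1}.
        ereal \<bar>x powr (2 * \<alpha> - 1 + real_of_ereal (1 / p)) * deriv (u_N \<alpha> p f) x\<bar>)"

end

theory Submission
  imports Defs
begin

text \<open>
The equation is a first-order system for \<open>u\<close> and its flux \<open>z = x powr (2 * \<alpha>) * u'\<close>, namely
\<open>z' = u - f\<close> with \<open>z \<rightarrow> 0\<close> at 0. With \<open>r = 1 / p\<close>, the quantity under the supremum is
\<open>x powr (r - 1) * \<bar>z x\<bar>\<close>, so the theorem says that the largest flux at \<open>x\<close> for data in the unit
ball of the Lebesgue space is comparable to \<open>x powr (1 - r)\<close>, which is what Hoelder's inequality
gives for the integral of \<open>\<bar>f\<bar>\<close> over \<open>{0..x}\<close>.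

For the upper bound a Green's function is available (\<open>neumann_solution_exists_bounded\<close>). Let
\<open>\<phi>\<close> be the solution of the homogeneous equation that is regular at 0, and \<open>\<psi>\<close> the one that
vanishes at 1 (\<open>fundamental_system\<close>). Then \<open>u\<close> is \<open>\<psi>\<close> times the integral of \<open>\<phi> * f\<close> over
\<open>{0..x}\<close> plus \<open>\<phi>\<close> times the integral of \<open>\<psi> * f\<close> over \<open>{x..1}\<close>. In the flux, the first
integral appears with a bounded factor and obeys the Hoelder bound; the second one appears with
a factor of order \<open>x\<close>, and this absorbs \<open>\<psi>\<close>, which grows more slowly than \<open>1 / x\<close> because
\<open>\<alpha> < 1\<close>. One pointwise inequality (\<open>weighted_integral_le_of_Lp_norm_le_1\<close>) covers all exponents.

For the lower bound the flux is prescribed as a bump of height proportional to \<open>x powr (1 - r)\<close> and width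
proportional to \<open>x\<close>, and the datum is read off from the equation; it has bounded norm by scaling
(\<open>neumann_solution_with_large_derivative\<close>).

Because \<open>u_N\<close> is defined by a description operator, both bounds rest on uniqueness
(\<open>neumann_solution_unique\<close>). A weak solution is first shown to be classical up to integrals
(\<open>weak_deriv_imp_primitive\<close>, a du Bois-Reymond lemma), and then the square of the flux of a
difference of two solutions is seen to decrease from the value 0. Functions with an integrable
density are handled throughout by \<open>primitive_on\<close>, whose product rule \<open>primitive_on_mult\<close>
serves both for integration against test functions and for variation of constants.
\<close>

section \<open>Functions given by integrating a density\<close>

text \<open>Summing the increments over a fine partition bounds the total change of \<open>D\<close> by an arbitrarily
small multiple of the change of \<open>K\<close>. This replaces the theory of absolutely continuous functions
in the product rule below, where \<open>D\<close> need not be differentiable anywhere.\<close>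

lemma eq_if_small_increments:
  fixes D K :: "real \<Rightarrow> real"
  assumes "c \<le> d"
    and small: "\<And>e. 0 < e \<Longrightarrow> \<exists>\<delta>>0. \<forall>x y. c \<le> x \<longrightarrow> x \<le> y \<longrightarrow> y \<le> d \<longrightarrow> y - x < \<delta> \<longrightarrow>
      \<bar>D y - D x\<bar> \<le> e * (K y - K x)"
  shows "D d = D c"
proof -
  have bound: "\<bar>D d - D c\<bar> \<le> e * (K d - K c)" if "0 < e" for e
  proof -
    obtain \<delta> where "0 < \<delta>" and "\<forall>x y. c \<le> x \<longrightarrow> x \<le> y \<longrightarrow> y \<le> d \<longrightarrow> y - x < \<delta> \<longrightarrow>
        \<bar>D y - D x\<bar> \<le> e * (K y - K x)"
      using small[OF \<open>0 < e\<close>] by blast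
    then have \<delta>: "\<bar>D y - D x\<bar> \<le> e * (K y - K x)" if "c \<le> x" "x \<le> y" "y \<le> d" "y - x < \<delta>" for x y
      using that by blast
    obtain n :: nat where n: "(d - c) / \<delta> < real n"
      using reals_Archimedean2 by blast
    have "0 \<le> (d - c) / \<delta>" using \<open>c \<le> d\<close> \<open>0 < \<delta>\<close> by simp
    with n have "0 < n" by (cases n) auto
    define t where "t i = c + real i * ((d - c) / real n)" for i
    have t_Suc: "t (Suc i) = t i + (d - c) / real n" for i
      by (simp only: t_def of_nat_Suc distrib_right)
    have step: "\<bar>D (t (Suc i)) - D (t i)\<bar> \<le> e * (K (t (Suc i)) - K (t i))" if "i < n" for i
    proof (rule \<delta>)
      show "c \<le> t i" using \<open>c \<le> d\<close> by (simp add: t_def)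
      show "t i \<le> t (Suc i)" using \<open>c \<le> d\<close> by (simp add: t_Suc)
      have "t (Suc i) \<le> c + real n * ((d - c) / real n)"
        unfolding t_def using \<open>c \<le> d\<close> that by (intro add_left_mono mult_right_mono) auto
      then show "t (Suc i) \<le> d" using \<open>0 < n\<close> by simp
      have "t (Suc i) - t i = (d - c) / real n" by (simp add: t_Suc)
      also have "\<dots> < \<delta>" using n \<open>0 < n\<close> \<open>0 < \<delta>\<close> by (simp add: field_simps)
      finally show "t (Suc i) - t i < \<delta>" .
    qed
    have ends: "t 0 = c" "t n = d" using \<open>0 < n\<close> by (simp_all add: t_def)
    have "\<bar>D d - D c\<bar> = \<bar>\<Sum>i<n. D (t (Suc i)) - D (t i)\<bar>"
      using sum_lessThan_telescope[of "\<lambda>i. D (t i)" n] ends by simp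
    also have "\<dots> \<le> (\<Sum>i<n. \<bar>D (t (Suc i)) - D (t i)\<bar>)" by (rule sum_abs)
    also have "\<dots> \<le> (\<Sum>i<n. e * (K (t (Suc i)) - K (t i)))" by (intro sum_mono step) auto
    also have "\<dots> = e * (K d - K c)"
      using sum_lessThan_telescope[of "\<lambda>i. K (t i)" n] ends by (simp flip: sum_distrib_left)
    finally show ?thesis .
  qed
  have "\<bar>D d - D c\<bar> \<le> 0"
  proof (rule field_le_epsilon)
    fix e :: real assume "0 < e"
    define k where "k = \<bar>K d - K c\<bar> + 1"
    have "\<bar>D d - D c\<bar> \<le> e / k * (K d - K c)" using bound[of "e / k"] \<open>0 < e\<close> by (simp add: k_def)
    also have "\<dots> \<le> e / k * k" using \<open>0 < e\<close> by (intro mult_left_mono) (auto simp: k_def)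
    also have "\<dots> = e" by (simp add: k_def)
    finally show "\<bar>D d - D c\<bar> \<le> 0 + e" by simp
  qed
  then show ?thesis by simp
qed

text \<open>This is local absolute continuity with a chosen density \<open>g\<close>, kept in integrated form
so that differentiation almost everywhere never enters.\<close>

definition primitive_on :: "real set \<Rightarrow> (real \<Rightarrow> real) \<Rightarrow> (real \<Rightarrow> real) \<Rightarrow> bool" where
  "primitive_on S u g \<longleftrightarrow> (\<forall>c\<in>S. \<forall>d\<in>S. c \<le> d \<longrightarrow>
     g absolutely_integrable_on {c..d} \<and> u d - u c = integral {c..d} g)"

lemma primitive_onD:
  assumes "primitive_on S u g" "c \<in> S" "d \<in> S" "c \<le> d"
  shows "g absolutely_integrable_on {c..d}" "g integrable_on {c..d}" "u d - u c = integral {c..d} g"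
  using assms by (auto simp: primitive_on_def intro: set_lebesgue_integral_eq_integral(1))

lemma primitive_on_subset: "primitive_on S u g \<Longrightarrow> T \<subseteq> S \<Longrightarrow> primitive_on T u g"
  unfolding primitive_on_def by blast

lemma primitive_on_continuous:
  assumes "primitive_on S u g" "{c..d} \<subseteq> S"
  shows "continuous_on {c..d} u"
proof (cases "c \<le> d")
  case True
  have eq: "u x = u c + integral {c..x} g" if "x \<in> {c..d}" for x
    using primitive_onD(3)[OF assms(1), of c x] that assms(2) True by force
  have "g integrable_on {c..d}"
    using primitive_onD(2)[OF assms(1), of c d] assms(2) True by force
  then have "continuous_on {c..d} (\<lambda>x. u c + integral {c..x} g)"
    by (intro continuous_intros indefinite_integral_continuous_1)
  then show ?thesis by (rule continuous_on_eq) (rule eq[symmetric])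
qed simp

lemma primitive_on_if_has_derivative:
  assumes deriv: "\<And>x. x \<in> S \<Longrightarrow> (u has_real_derivative g x) (at x within S)"
    and "is_interval S" and g: "continuous_on S g"
  shows "primitive_on S u g"
  unfolding primitive_on_def
proof (intro ballI impI conjI)
  fix c d assume "c \<in> S" "d \<in> S" "c \<le> d"
  with \<open>is_interval S\<close> have sub: "{c..d} \<subseteq> S"
    by (meson atLeastAtMost_iff mem_is_interval_1_I subsetI)
  show "g absolutely_integrable_on {c..d}"
    by (intro absolutely_integrable_continuous_real continuous_on_subset[OF g sub])
  have "(g has_integral (u d - u c)) {c..d}"
    using sub \<open>c \<le> d\<close>
    by (intro fundamental_theorem_of_calculus)
      (auto simp flip: has_real_derivative_iff_has_vector_derivative intro!: DERIV_subset[OF deriv])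
  then show "u d - u c = integral {c..d} g" by (simp add: integral_unique)
qed

lemma primitive_on_DERIV:
  assumes "primitive_on S u g" "is_interval S" "continuous_on S g" "x \<in> interior S"
  shows "(u has_real_derivative g x) (at x)"
proof -
  obtain e where "0 < e" and e: "cball x e \<subseteq> S" using assms(4) by (meson mem_interior_cball)
  then have sub: "{x - e..x + e} \<subseteq> S" by (simp add: cball_eq_atLeastAtMost)
  have "((\<lambda>t. integral {x - e..t} g) has_real_derivative g x) (at x within {x - e..x + e})"
    using \<open>0 < e\<close> sub assms(3)
    by (intro integral_has_real_derivative continuous_on_subset[OF assms(3)]) auto
  then have "((\<lambda>t. u (x - e) + integral {x - e..t} g) has_real_derivative g x) (at x within {x - e..x + e})"
    by (auto intro!: derivative_eq_intros)
  moreover have "u (x - e) + integral {x - e..t} g = u t" if "t \<in> {x - e..x + e}" for t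
    using primitive_onD(3)[OF assms(1), of "x - e" t] that sub \<open>0 < e\<close> by force
  ultimately have "(u has_real_derivative g x) (at x within {x - e..x + e})"
    using \<open>0 < e\<close> by (elim has_field_derivative_transform_within[where d = e]) auto
  then show ?thesis
    using \<open>0 < e\<close> at_within_Icc_at[of "x - e" x "x + e"] by simp
qed

lemma primitive_on_add:
  assumes "primitive_on S u g" "primitive_on S w h"
  shows "primitive_on S (\<lambda>x. u x + w x) (\<lambda>x. g x + h x)"
  unfolding primitive_on_def
proof (intro ballI impI conjI)
  fix c d assume cd: "c \<in> S" "d \<in> S" "c \<le> d"
  note u = primitive_onD[OF assms(1) cd] and w = primitive_onD[OF assms(2) cd]
  show "(\<lambda>x. g x + h x) absolutely_integrable_on {c..d}"
    using u w by (intro set_integral_add)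
  show "u d + w d - (u c + w c) = integral {c..d} (\<lambda>x. g x + h x)"
    using u w by (simp add: integral_add)
qed

lemma primitive_on_cmult:
  assumes "primitive_on S u g"
  shows "primitive_on S (\<lambda>x. k * u x) (\<lambda>x. k * g x)"
  unfolding primitive_on_def
proof (intro ballI impI conjI)
  fix c d assume cd: "c \<in> S" "d \<in> S" "c \<le> d"
  note u = primitive_onD[OF assms(1) cd]
  show "(\<lambda>x. k * g x) absolutely_integrable_on {c..d}"
    using u by (intro set_integrable_mult_right)
  show "k * u d - k * u c = integral {c..d} (\<lambda>x. k * g x)"
    using u by (simp flip: right_diff_distrib)
qed

lemma primitive_on_diff:
  assumes "primitive_on S u g" "primitive_on S w h"
  shows "primitive_on S (\<lambda>x. u x - w x) (\<lambda>x. g x - h x)"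
  using primitive_on_add[OF assms(1) primitive_on_cmult[OF assms(2), of "-1"]] by simp

lemma primitive_on_cong:
  assumes "primitive_on S u g" "is_interval S"
    and "\<And>x. x \<in> S \<Longrightarrow> u x = w x" "\<And>x. x \<in> S \<Longrightarrow> g x = h x"
  shows "primitive_on S w h"
  unfolding primitive_on_def
proof (intro ballI impI)
  fix c d assume cd: "c \<in> S" "d \<in> S" "c \<le> d"
  with \<open>is_interval S\<close> have "{c..d} \<subseteq> S"
    by (meson atLeastAtMost_iff mem_is_interval_1_I subsetI)
  then have eq: "g x = h x" if "x \<in> {c..d}" for x using assms(4) that by blast
  have "g absolutely_integrable_on {c..d} \<longleftrightarrow> h absolutely_integrable_on {c..d}"
    by (intro set_integrable_cong) (use eq in auto)
  moreover have "integral {c..d} g = integral {c..d} h" by (intro integral_cong eq)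
  ultimately show "h absolutely_integrable_on {c..d} \<and> w d - w c = integral {c..d} h"
    using primitive_onD[OF assms(1) cd] assms(3) cd by simp
qed

lemma absolutely_integrable_continuous_mult:
  fixes u g :: "real \<Rightarrow> real"
  assumes "continuous_on {c..d} u" "g absolutely_integrable_on {c..d}"
  shows "(\<lambda>x. u x * g x) absolutely_integrable_on {c..d}"
proof (rule absolutely_integrable_bounded_measurable_product_real)
  show "u \<in> borel_measurable (lebesgue_on {c..d})"
    by (intro continuous_imp_measurable_on_sets_lebesgue assms) auto
  show "bounded (u ` {c..d})"
    by (intro compact_imp_bounded compact_continuous_image assms) auto
qed (use assms in auto)

text \<open>Over a short interval \<open>{x..y}\<close> the difference between the two sides is the integral of
\<open>(u y - u s) * h s + (w x - w s) * g s\<close>. By uniform continuity of \<open>u\<close> and \<open>w\<close> it is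
small relative to the integral of \<open>\<bar>h\<bar> + \<bar>g\<bar>\<close>, so that no increment is left in total.\<close>

lemma primitive_on_mult:
  assumes "primitive_on S u g" "primitive_on S w h" "is_interval S"
  shows "primitive_on S (\<lambda>x. u x * w x) (\<lambda>x. u x * h x + w x * g x)"
  unfolding primitive_on_def
proof (intro ballI impI conjI)
  fix c d assume cd: "c \<in> S" "d \<in> S" "c \<le> d"
  with \<open>is_interval S\<close> have sub: "{c..d} \<subseteq> S"
    by (meson atLeastAtMost_iff mem_is_interval_1_I subsetI)
  note cu = primitive_on_continuous[OF assms(1) sub] and cw = primitive_on_continuous[OF assms(2) sub]
  note g = primitive_onD[OF assms(1) cd] and h = primitive_onD[OF assms(2) cd]
  have uh: "(\<lambda>x. u x * h x) absolutely_integrable_on {c..d}"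
    by (intro absolutely_integrable_continuous_mult cu h)
  have wg: "(\<lambda>x. w x * g x) absolutely_integrable_on {c..d}"
    by (intro absolutely_integrable_continuous_mult cw g)
  show ai: "(\<lambda>x. u x * h x + w x * g x) absolutely_integrable_on {c..d}"
    by (intro set_integral_add uh wg)
  define F where "F x = u x * h x + w x * g x" for x
  define D where "D x = u x * w x - integral {c..x} F" for x
  define K where "K x = integral {c..x} (\<lambda>s. \<bar>h s\<bar> + \<bar>g s\<bar>)" for x
  have absint: "(\<lambda>s. \<bar>h s\<bar> + \<bar>g s\<bar>) integrable_on {c..d}"
    using g h by (intro integrable_add) (auto simp: absolutely_integrable_on_def)
  have Fint: "F integrable_on {c..d}"
    using ai unfolding F_def by (rule set_lebesgue_integral_eq_integral(1))
  have "D d = D c"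
  proof (rule eq_if_small_increments[where D = D and c = c and d = d and K = K])
    fix e :: real assume "0 < e"
    obtain \<delta>1 where "0 < \<delta>1" and \<delta>1: "\<And>x y. x \<in> {c..d} \<Longrightarrow> y \<in> {c..d} \<Longrightarrow> dist y x < \<delta>1 \<Longrightarrow> dist (u y) (u x) < e"
      using compact_uniformly_continuous[OF cu] \<open>0 < e\<close> unfolding uniformly_continuous_on_def by (metis compact_Icc)
    obtain \<delta>2 where "0 < \<delta>2" and \<delta>2: "\<And>x y. x \<in> {c..d} \<Longrightarrow> y \<in> {c..d} \<Longrightarrow> dist y x < \<delta>2 \<Longrightarrow> dist (w y) (w x) < e"
      using compact_uniformly_continuous[OF cw] \<open>0 < e\<close> unfolding uniformly_continuous_on_def by (metis compact_Icc)
    show "\<exists>\<delta>>0. \<forall>x y. c \<le> x \<longrightarrow> x \<le> y \<longrightarrow> y \<le> d \<longrightarrow> y - x < \<delta> \<longrightarrow> \<bar>D y - D x\<bar> \<le> e * (K y - K x)"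
    proof (intro exI[of _ "min \<delta>1 \<delta>2"] conjI allI impI)
      show "0 < min \<delta>1 \<delta>2" using \<open>0 < \<delta>1\<close> \<open>0 < \<delta>2\<close> by simp
      fix x y assume xy: "c \<le> x" "x \<le> y" "y \<le> d" "y - x < min \<delta>1 \<delta>2"
      then have sub': "{x..y} \<subseteq> {c..d}" by auto
      have inS: "x \<in> S" "y \<in> S" using xy sub by auto
      note gx = primitive_onD[OF assms(1) inS xy(2)] and hx = primitive_onD[OF assms(2) inS xy(2)]
      have uhx: "(\<lambda>s. u s * h s) integrable_on {x..y}" and wgx: "(\<lambda>s. w s * g s) integrable_on {x..y}"
        using absolutely_integrable_on_subinterval[OF uh sub'] absolutely_integrable_on_subinterval[OF wg sub']
        by (auto intro: set_lebesgue_integral_eq_integral(1))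
      have split: "integral {c..y} F - integral {c..x} F = integral {x..y} F"
        using Henstock_Kurzweil_Integration.integral_combine[of c x y F] xy
          integrable_subinterval_real[OF Fint, of c y] by simp
      have splitK: "K y - K x = integral {x..y} (\<lambda>s. \<bar>h s\<bar> + \<bar>g s\<bar>)"
        unfolding K_def using Henstock_Kurzweil_Integration.integral_combine[of c x y "\<lambda>s. \<bar>h s\<bar> + \<bar>g s\<bar>"] xy
          integrable_subinterval_real[OF absint, of c y] by simp
      have "integral {x..y} F = integral {x..y} (\<lambda>s. u s * h s) + integral {x..y} (\<lambda>s. w s * g s)"
        unfolding F_def by (intro integral_add uhx wgx)
      then have "D y - D x = u y * (w y - w x) + w x * (u y - u x)
          - (integral {x..y} (\<lambda>s. u s * h s) + integral {x..y} (\<lambda>s. w s * g s))"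
        using split by (simp add: D_def algebra_simps)
      also have "\<dots> = integral {x..y} (\<lambda>s. u y * h s) + integral {x..y} (\<lambda>s. w x * g s)
          - (integral {x..y} (\<lambda>s. u s * h s) + integral {x..y} (\<lambda>s. w s * g s))"
        using gx hx by simp
      also have "\<dots> = integral {x..y} (\<lambda>s. (u y - u s) * h s + (w x - w s) * g s)"
      proof -
        have "integral {x..y} (\<lambda>s. (u y * h s + w x * g s) - (u s * h s + w s * g s))
            = integral {x..y} (\<lambda>s. u y * h s + w x * g s) - integral {x..y} (\<lambda>s. u s * h s + w s * g s)"
          using gx hx uhx wgx by (intro integral_diff integrable_add integrable_on_mult_right) auto
        also have "\<dots> = (integral {x..y} (\<lambda>s. u y * h s) + integral {x..y} (\<lambda>s. w x * g s))
           - (integral {x..y} (\<lambda>s. u s * h s) + integral {x..y} (\<lambda>s. w s * g s))"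
          using gx hx uhx wgx by (subst (1 2) integral_add) (auto intro!: integrable_on_mult_right)
        finally show ?thesis by (simp add: algebra_simps)
      qed
      also have "\<bar>\<dots>\<bar> \<le> integral {x..y} (\<lambda>s. e * (\<bar>h s\<bar> + \<bar>g s\<bar>))"
        unfolding real_norm_def[symmetric]
      proof (rule integral_norm_bound_integral)
        have "(\<lambda>s. (u y * h s + w x * g s) - (u s * h s + w s * g s)) integrable_on {x..y}"
          using gx hx uhx wgx by (intro integrable_diff integrable_add integrable_on_mult_right) auto
        then show "(\<lambda>s. (u y - u s) * h s + (w x - w s) * g s) integrable_on {x..y}"
          by (simp add: algebra_simps)
        show "(\<lambda>s. e * (norm (h s) + norm (g s))) integrable_on {x..y}"
          using integrable_subinterval_real[OF absint sub'] by (intro integrable_on_mult_right) simp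
        fix s assume s: "s \<in> {x..y}"
        have "\<bar>u y - u s\<bar> \<le> e" "\<bar>w x - w s\<bar> \<le> e"
          using \<delta>1[of s y] \<delta>2[of s x] s xy by (auto simp: dist_real_def intro: less_imp_le)
        then have "\<bar>u y - u s\<bar> * \<bar>h s\<bar> + \<bar>w x - w s\<bar> * \<bar>g s\<bar> \<le> e * \<bar>h s\<bar> + e * \<bar>g s\<bar>"
          by (intro add_mono mult_right_mono) auto
        then show "norm ((u y - u s) * h s + (w x - w s) * g s) \<le> e * (norm (h s) + norm (g s))"
          using abs_triangle_ineq[of "(u y - u s) * h s" "(w x - w s) * g s"]
          by (simp add: abs_mult distrib_left)
      qed
      also have "\<dots> = e * (K y - K x)" using splitK by simp
      finally show "\<bar>D y - D x\<bar> \<le> e * (K y - K x)" .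
    qed
  qed fact
  then show "u d * w d - u c * w c = integral {c..d} (\<lambda>x. u x * h x + w x * g x)"
    by (simp add: D_def F_def[abs_def] algebra_simps)
qed

section \<open>Weak derivatives on an interval\<close>

lemma LINT_lebesgue_on_eq_integral_of_support:
  fixes F :: "real \<Rightarrow> real"
  assumes "F absolutely_integrable_on {c..d}" "{c..d} \<subseteq> {a<..<b}"
    and zero: "\<And>x. x \<notin> {c..d} \<Longrightarrow> F x = 0"
  shows "(LINT x|lebesgue_on {a<..<b}. F x) = integral {c..d} F"
proof -
  have "F absolutely_integrable_on {a<..<b}"
    using assms(1)
  proof (rule absolutely_integrable_spike_set)
    show "negligible {x \<in> {c..d} - {a<..<b}. F x \<noteq> 0}" 
      using assms(2) by (auto simp: Diff_eq_empty_iff[THEN iffD2])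
    show "negligible {x \<in> {a<..<b} - {c..d}. F x \<noteq> 0}" 
      using zero by (auto intro!: negligible_subset[OF negligible_empty])
  qed
  then have "integrable (lebesgue_on {a<..<b}) F"
    by (simp add: integrable_restrict_space set_integrable_def)
  then have "(LINT x|lebesgue_on {a<..<b}. F x) = integral {a<..<b} F"
    by (intro lebesgue_integral_eq_integral) auto
  also have "\<dots> = integral {c..d} F"
    using assms(2) zero by (intro integral_spike_set negligible_subset[OF negligible_empty]) auto
  finally show ?thesis .
qed

lemma test_function_support:
  assumes "test_function a b \<phi>" "a < b"
  obtains c d where "a < c" "c < d" "d < b"
    "\<And>x. x \<notin> {c..d} \<Longrightarrow> \<phi> x = 0" "\<And>x. x \<notin> {c..d} \<Longrightarrow> deriv \<phi> x = 0"
    "\<phi> c = 0" "\<phi> d = 0"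
    "\<And>x. (\<phi> has_real_derivative deriv \<phi> x) (at x)" "continuous_on UNIV (deriv \<phi>)"
proof -
  let ?S = "closure {x. \<phi> x \<noteq> 0}"
  have C1: "\<phi> C1_differentiable_on UNIV" and S: "compact ?S" "?S \<subseteq> {a<..<b}"
    using assms by (auto simp: test_function_def)
  obtain D where D: "\<And>x. (\<phi> has_vector_derivative D x) (at x)" and contD: "continuous_on UNIV D"
    using C1 by (auto simp: C1_differentiable_on_def)
  have D': "(\<phi> has_real_derivative D x) (at x)" for x
    using D by (simp add: has_real_derivative_iff_has_vector_derivative)
  then have deq: "deriv \<phi> = D" by (intro ext DERIV_imp_deriv)
  obtain c0 d0 where cd0: "a < c0" "c0 \<le> d0" "d0 < b" "?S \<subseteq> {c0..d0}"
  proof (cases "?S = {}")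
    case True
    then show ?thesis using that[of "(a+b)/2" "(a+b)/2"] assms(2) by auto
  next
    case False
    obtain m where m: "m \<in> ?S" "\<forall>x\<in>?S. m \<le> x"
      using compact_attains_inf[OF S(1) False] by blast
    obtain M where M: "M \<in> ?S" "\<forall>x\<in>?S. x \<le> M"
      using compact_attains_sup[OF S(1) False] by blast
    have "a < m" "M < b" using m M S(2) by auto
    moreover have "m \<le> M" using m M by blast
    moreover have "?S \<subseteq> {m..M}" using m(2) M(2) by auto
    ultimately show ?thesis using that by blast
  qed
  \<comment> \<open>Enlarging the support a little makes the test function vanish at \<open>c\<close> and \<open>d\<close> themselves.\<close>
  define c d where "c = (a + c0) / 2" and "d = (d0 + b) / 2"
  have cd: "a < c" "c < c0" "d0 < d" "d < b" using cd0 by (auto simp: c_def d_def)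
  have zero: "\<phi> x = 0" if "x \<notin> {c0..d0}" for x
    using that cd0(4) closure_subset[of "{x. \<phi> x \<noteq> 0}"] by auto
  have zero': "deriv \<phi> x = 0" if "x \<notin> {c..d}" for x
  proof -
    have "open (- {c0..d0})" "x \<in> - {c0..d0}" using that cd by auto
    then have "eventually (\<lambda>y. y \<in> - {c0..d0}) (nhds x)" by (rule eventually_nhds_in_open)
    then have "eventually (\<lambda>y. \<phi> y = 0) (nhds x)" by eventually_elim (use zero in auto)
    then have "deriv \<phi> x = deriv (\<lambda>_. 0) x" by (intro deriv_cong_ev) auto
    then show ?thesis by simp
  qed
  show ?thesis
  proof (rule that[of c d])
    show "\<phi> x = 0" if "x \<notin> {c..d}" for x using that cd by (intro zero) auto
    show "\<phi> c = 0" "\<phi> d = 0" using cd by (auto intro!: zero)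
    show "(\<phi> has_real_derivative deriv \<phi> x) (at x)" for x using D' deq by simp
  qed (use cd cd0 zero' deq contD in auto)
qed

text \<open>The product rule applied to \<open>u * \<phi>\<close>, which vanishes at both ends of an interval containing the
support of the test function.\<close>

lemma primitive_on_imp_weak_deriv:
  assumes u: "primitive_on {a<..<b} u g" and "a < b"
  shows "has_weak_deriv a b u g"
proof -
  have sub: "{c..d} \<subseteq> {a<..<b}" if "a < c" "d < b" for c d using that by auto
  have "locally_integrable a b u"
    unfolding locally_integrable_def
    by (intro allI impI absolutely_integrable_continuous_real primitive_on_continuous[OF u]) auto
  moreover have "locally_integrable a b g"
    unfolding locally_integrable_def
    by (intro allI impI primitive_onD(1)[OF u]) auto
  moreover have "(LINT x|lebesgue_on {a<..<b}. u x * deriv \<phi> x) = - (LINT x|lebesgue_on {a<..<b}. g x * \<phi> x)"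
    if t: "test_function a b \<phi>" for \<phi>
  proof -
    obtain c d where cd: "a < c" "c < d" "d < b"
      and zero: "\<And>x. x \<notin> {c..d} \<Longrightarrow> \<phi> x = 0" "\<And>x. x \<notin> {c..d} \<Longrightarrow> deriv \<phi> x = 0" "\<phi> c = 0" "\<phi> d = 0"
      and D: "\<And>x. (\<phi> has_real_derivative deriv \<phi> x) (at x)" "continuous_on UNIV (deriv \<phi>)"
      using test_function_support[OF t \<open>a < b\<close>] by metis
    have "primitive_on {a<..<b} \<phi> (deriv \<phi>)"
      using D by (intro primitive_on_if_has_derivative)
        (auto intro: has_field_derivative_at_within continuous_on_subset is_interval_oo)
    from primitive_on_mult[OF u this] 
    have prod: "primitive_on {a<..<b} (\<lambda>x. u x * \<phi> x) (\<lambda>x. u x * deriv \<phi> x + \<phi> x * g x)"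
      by (simp add: is_interval_oo)
    have contphi: "continuous_on {c..d} \<phi>"
      using D(1) by (intro DERIV_continuous_on) (auto intro: has_field_derivative_at_within)
    have 1: "(\<lambda>x. u x * deriv \<phi> x) absolutely_integrable_on {c..d}"
      using cd D(2) by (intro absolutely_integrable_continuous_real continuous_intros
        primitive_on_continuous[OF u] sub) (auto intro: continuous_on_subset)
    have 2: "(\<lambda>x. \<phi> x * g x) absolutely_integrable_on {c..d}"
      using cd by (intro absolutely_integrable_continuous_mult contphi primitive_onD(1)[OF u]) auto
    have "integral {c..d} (\<lambda>x. u x * deriv \<phi> x) + integral {c..d} (\<lambda>x. \<phi> x * g x)
      = integral {c..d} (\<lambda>x. u x * deriv \<phi> x + \<phi> x * g x)"
      using 1 2 by (intro integral_add[symmetric]) (auto intro: set_lebesgue_integral_eq_integral(1))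
    also have "\<dots> = 0"
      using primitive_onD(3)[OF prod, of c d] cd zero by simp
    finally have "integral {c..d} (\<lambda>x. u x * deriv \<phi> x) = - integral {c..d} (\<lambda>x. g x * \<phi> x)"
      by (simp add: mult.commute)
    moreover have "(LINT x|lebesgue_on {a<..<b}. u x * deriv \<phi> x) = integral {c..d} (\<lambda>x. u x * deriv \<phi> x)"
      using 1 cd zero by (intro LINT_lebesgue_on_eq_integral_of_support sub) auto
    moreover have "(LINT x|lebesgue_on {a<..<b}. g x * \<phi> x) = integral {c..d} (\<lambda>x. g x * \<phi> x)"
      using 2 cd zero by (intro LINT_lebesgue_on_eq_integral_of_support sub) (auto simp: mult.commute)
    ultimately show ?thesis by simp
  qed
  ultimately show ?thesis by (simp add: has_weak_deriv_def)
qed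

text \<open>Compact support and mean zero make a continuous function the derivative of a test function;
this supplies the test functions for the du Bois-Reymond argument.\<close>

lemma test_function_antiderivative:
  fixes \<psi> :: "real \<Rightarrow> real"
  assumes cont: "continuous_on UNIV \<psi>" and cd: "a < c" "c \<le> d" "d < b"
    and zero: "\<And>x. x \<notin> {c..d} \<Longrightarrow> \<psi> x = 0" and mean: "integral {c..d} \<psi> = 0"
  obtains \<phi> where "test_function a b \<phi>" "deriv \<phi> = \<psi>"
proof -
  \<comment> \<open>Starting at \<open>c - 1\<close> makes every \<open>x \<ge> c\<close> interior to the domain of integration.\<close>
  define \<phi> where "\<phi> x = integral {c - 1..x} \<psi>" for x
  have int: "\<psi> integrable_on {x..y}" for x y
    by (intro integrable_continuous_real continuous_on_subset[OF cont]) auto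
  have left: "\<phi> x = 0" if "x < c" for x
  proof -
    have "\<phi> x = integral {c - 1..x} (\<lambda>_. 0)"
      unfolding \<phi>_def by (intro Henstock_Kurzweil_Integration.integral_cong) (use that zero in auto)
    then show ?thesis by simp
  qed
  have right: "\<phi> x = 0" if "d < x" for x
  proof -
    have "\<phi> x = integral {c - 1..c} \<psi> + (integral {c..d} \<psi> + integral {d..x} \<psi>)"
      unfolding \<phi>_def using that cd
      by (simp add: Henstock_Kurzweil_Integration.integral_combine int)
    moreover have "integral {c - 1..c} \<psi> = integral {c - 1..c} (\<lambda>_. 0)"
      by (rule integral_spike[of "{c}"]) (auto simp: zero)
    moreover have "integral {d..x} \<psi> = integral {d..x} (\<lambda>_. 0)"
      by (rule integral_spike[of "{d}"]) (use cd in \<open>auto simp: zero\<close>)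
    ultimately show ?thesis using mean by simp
  qed
  have D: "(\<phi> has_real_derivative \<psi> x) (at x)" for x
  proof (cases "x < c")
    case True
    then have "eventually (\<lambda>y. y < c) (nhds x)" 
      by (intro eventually_nhds_in_open[of "{..<c}", simplified]) auto
    then have ev: "eventually (\<lambda>y. \<phi> y = 0) (nhds x)" by eventually_elim (rule left)
    have "((\<lambda>_. 0) has_real_derivative 0) (at x)" by simp
    then have "(\<phi> has_real_derivative 0) (at x)" 
      using ev by (subst DERIV_cong_ev[OF refl _ refl]) auto
    then show ?thesis using True zero by simp
  next
    case False
    have "(\<phi> has_real_derivative \<psi> x) (at x within {c - 1..x + 1})"
      unfolding \<phi>_def using False
      by (intro integral_has_real_derivative continuous_on_subset[OF cont]) auto
    then show ?thesis using False at_within_Icc_at[of "c - 1" x "x + 1"] by simp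
  qed
  have "{x. \<phi> x \<noteq> 0} \<subseteq> {c..d}" using left right by force
  then have cl: "closure {x. \<phi> x \<noteq> 0} \<subseteq> {c..d}" by (simp add: closure_minimal)
  have "test_function a b \<phi>"
    unfolding test_function_def
  proof (intro conjI)
    show "\<phi> C1_differentiable_on UNIV"
      unfolding C1_differentiable_on_def using D cont
      by (auto simp: has_real_derivative_iff_has_vector_derivative)
    show "compact (closure {x. \<phi> x \<noteq> 0})"
      using cl bounded_subset[OF bounded_closed_interval] by (auto simp: compact_eq_bounded_closed)
    show "closure {x. \<phi> x \<noteq> 0} \<subseteq> {a<..<b}" using cl cd by force
  qed
  moreover have "deriv \<phi> = \<psi>" using D by (intro ext DERIV_imp_deriv)
  ultimately show ?thesis by (rule that)
qed

text \<open>Continuous plateau functions supported in \<open>{c..d}\<close>, increasing in \<open>n\<close> to the indicator of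
the open interval.\<close>

definition trapezoid :: "real \<Rightarrow> real \<Rightarrow> nat \<Rightarrow> real \<Rightarrow> real" where
  "trapezoid c d n x = max 0 (min 1 (real n * min (x - c) (d - x)))"

lemma trapezoid_continuous: "continuous_on A (trapezoid c d n)"
  unfolding trapezoid_def by (intro continuous_intros)

lemma trapezoid_bounds: "0 \<le> trapezoid c d n x" "trapezoid c d n x \<le> 1"
  by (auto simp: trapezoid_def)

lemma trapezoid_outside: "x \<notin> {c<..<d} \<Longrightarrow> trapezoid c d n x = 0"
proof -
  assume "x \<notin> {c<..<d}"
  then have "real n * min (x - c) (d - x) \<le> 0" by (intro mult_nonneg_nonpos) auto
  then show ?thesis by (simp add: trapezoid_def)
qed

lemma trapezoid_tendsto: "(\<lambda>n. trapezoid c d n x) \<longlonglongrightarrow> (if x \<in> {c<..<d} then 1 else 0)"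
proof (cases "x \<in> {c<..<d}")
  case True
  define m where "m = min (x - c) (d - x)"
  have "0 < m" using True by (simp add: m_def)
  obtain N :: nat where N: "1 / m < real N" using reals_Archimedean2 by blast
  have "trapezoid c d n x = 1" if "N \<le> n" for n
  proof -
    have "1 / m < real n" using N that by linarith
    then have "1 < real n * m" using \<open>0 < m\<close> by (simp add: field_simps)
    then show ?thesis by (simp add: trapezoid_def flip: m_def)
  qed
  then have "eventually (\<lambda>n. trapezoid c d n x = 1) sequentially"
    by (auto simp: eventually_sequentially)
  then show ?thesis using True by (simp add: tendsto_eventually)
next
  case False
  then show ?thesis by (simp only: trapezoid_outside[OF False] if_False tendsto_const)
qed

lemma integral_trapezoid_mult_tendsto:
  assumes "h absolutely_integrable_on {c..d}"
  shows "(\<lambda>n. integral {c..d} (\<lambda>x. trapezoid c d n x * h x)) \<longlonglongrightarrow> integral {c..d} h"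
proof -
  have "(\<lambda>n. integral {c..d} (\<lambda>x. trapezoid c d n x * h x)) \<longlonglongrightarrow>
      integral {c..d} (\<lambda>x. (if x \<in> {c<..<d} then 1 else 0) * h x)"
  proof (rule dominated_convergence(2))
    show "(\<lambda>x. trapezoid c d n x * h x) integrable_on {c..d}" for n
      by (intro set_lebesgue_integral_eq_integral(1) absolutely_integrable_continuous_mult
          trapezoid_continuous assms)
    show "(\<lambda>x. \<bar>h x\<bar>) integrable_on {c..d}"
      using assms by (simp add: absolutely_integrable_on_def)
    show "norm (trapezoid c d n x * h x) \<le> \<bar>h x\<bar>" for n x
      using trapezoid_bounds[of c d n x] by (simp add: abs_mult mult_left_le_one_le)
    show "(\<lambda>n. trapezoid c d n x * h x) \<longlonglongrightarrow> (if x \<in> {c<..<d} then 1 else 0) * h x" for x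
      by (intro tendsto_intros trapezoid_tendsto)
  qed
  also have "integral {c..d} (\<lambda>x. (if x \<in> {c<..<d} then 1 else 0) * h x) = integral {c..d} h"
    by (rule integral_spike[of "{c, d}"]) auto
  finally show ?thesis .
qed

lemma locally_integrable_subinterval:
  "locally_integrable a b h \<Longrightarrow> a < c \<Longrightarrow> d < b \<Longrightarrow> h absolutely_integrable_on {c..d}"
  using absolutely_integrable_on_null[of c c h]
  by (cases c d rule: linorder_cases) (auto simp: locally_integrable_def)

text \<open>The du Bois-Reymond lemma in integrated form. Subtracting a multiple of a fixed bump \<open>\<rho>\<close> turns
every continuous compactly supported \<open>\<psi>\<close> into the derivative of a test function, so that the
integral of \<open>h * \<psi>\<close> is a constant multiple of the integral of \<open>\<psi>\<close>. Letting \<open>\<psi>\<close> run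
through trapezoids gives the claim on intervals, without Lebesgue points of \<open>h\<close>.\<close>

lemma integral_eq_if_weak_deriv_zero:
  assumes h: "locally_integrable a b h" and "a < b"
    and zero: "\<And>\<phi>. test_function a b \<phi> \<Longrightarrow> (LINT x|lebesgue_on {a<..<b}. h x * deriv \<phi> x) = 0"
  obtains m where "\<And>c d. a < c \<Longrightarrow> c \<le> d \<Longrightarrow> d < b \<Longrightarrow> integral {c..d} h = m * (d - c)"
proof -
  define I :: "(real \<Rightarrow> real) \<Rightarrow> real" where "I \<psi> = (LINT x|lebesgue_on {a<..<b}. h x * \<psi> x)" for \<psi>
  have ai: "(\<lambda>x. h x * \<psi> x) absolutely_integrable_on {c..d}"
    if "continuous_on UNIV \<psi>" "a < c" "d < b" for \<psi> c d
    using absolutely_integrable_continuous_mult[OF continuous_on_subset[OF that(1)] locally_integrable_subinterval[OF h that(2,3)]]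
    by (simp add: mult.commute)
  have I: "I \<psi> = integral {c..d} (\<lambda>x. h x * \<psi> x)" 
    if "continuous_on UNIV \<psi>" "a < c" "d < b" "\<And>x. x \<notin> {c..d} \<Longrightarrow> \<psi> x = 0" for \<psi> c d
    unfolding I_def using that
    by (intro LINT_lebesgue_on_eq_integral_of_support ai) auto
  \<comment> \<open>A trapezoid on the middle third with positive mass serves as the fixed bump.\<close>
  define p q where "p = (2 * a + b) / 3" and "q = (a + 2 * b) / 3"
  have pq: "a < p" "p < q" "q < b" using \<open>a < b\<close> by (auto simp: p_def q_def field_simps)
  obtain N where N: "integral {p..q} (trapezoid p q N) > 0"
  proof -
    have "(\<lambda>n. integral {p..q} (\<lambda>x. trapezoid p q n x * 1)) \<longlonglongrightarrow> integral {p..q} (\<lambda>_. 1)"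
      by (intro integral_trapezoid_mult_tendsto absolutely_integrable_continuous_real) simp
    moreover have "integral {p..q} (\<lambda>_. 1::real) > 0" using pq by simp
    ultimately have "eventually (\<lambda>n. integral {p..q} (\<lambda>x. trapezoid p q n x * 1) > 0) sequentially"
      by (rule order_tendstoD)
    then show ?thesis using that by (auto simp: eventually_sequentially)
  qed
  define \<rho> where "\<rho> = trapezoid p q N"
  define R where "R = integral {p..q} \<rho>"
  have "R > 0" using N by (simp add: R_def \<rho>_def)
  have \<rho>: "continuous_on A \<rho>" "x \<notin> {p..q} \<Longrightarrow> \<rho> x = 0" for A x
    by (auto simp: \<rho>_def trapezoid_continuous trapezoid_outside)
  define m where "m = I \<rho> / R"
  have key: "I \<psi> = m * integral {c..d} \<psi>"
    if \<psi>: "continuous_on UNIV \<psi>" and cd: "a < c" "c \<le> d" "d < b" and zero\<psi>: "\<And>x. x \<notin> {c..d} \<Longrightarrow> \<psi> x = 0" for \<psi> c d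
  proof -
    define c' d' where "c' = min c p" and "d' = max d q"
    have cd': "a < c'" "c' \<le> d'" "d' < b" using cd pq by (auto simp: c'_def d'_def)
    define k where "k = integral {c..d} \<psi> / R"
    have ext: "integral {c'..d'} F = integral {s..t} F"
      if "\<And>x. x \<notin> {s..t} \<Longrightarrow> F x = 0" "{s..t} \<subseteq> {c'..d'}" for F :: "real \<Rightarrow> real" and s t
      using that by (intro integral_spike_set negligible_subset[OF negligible_empty]) auto
    have cint: "F integrable_on {s..t}" if "continuous_on UNIV F" for F :: "real \<Rightarrow> real" and s t
      using that by (intro integrable_continuous_real) (auto intro: continuous_on_subset)
    define \<tau> where "\<tau> x = \<psi> x - k * \<rho> x" for x
    have \<tau>: "continuous_on UNIV \<tau>" unfolding \<tau>_def by (intro continuous_intros \<psi> \<rho>)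
    have \<psi>0: "\<psi> x = 0" and \<rho>0: "\<rho> x = 0" if "x \<notin> {c'..d'}" for x
      using that by (auto simp: c'_def d'_def intro!: zero\<psi> \<rho>(2))
    then have \<tau>0: "\<tau> x = 0" if "x \<notin> {c'..d'}" for x
      using that by (simp add: \<tau>_def)
    have "integral {c'..d'} \<tau> = integral {c'..d'} \<psi> - k * integral {c'..d'} \<rho>"
      unfolding \<tau>_def by (subst integral_diff) (auto intro!: cint \<psi> \<rho> continuous_intros)
    also have "\<dots> = integral {c..d} \<psi> - k * R"
      unfolding R_def using ext[of c d \<psi>] ext[of p q \<rho>] zero\<psi> \<rho>(2) by (simp add: c'_def d'_def)
    also have "\<dots> = 0" using \<open>R > 0\<close> by (simp add: k_def)
    finally obtain \<phi> where "test_function a b \<phi>" "deriv \<phi> = \<tau>"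
      using test_function_antiderivative[OF \<tau> cd' \<tau>0] by metis
    then have "0 = I \<tau>" using zero by (auto simp: I_def)
    also have "\<dots> = integral {c'..d'} (\<lambda>x. h x * \<psi> x - k * (h x * \<rho> x))"
      using I[OF \<tau> cd'(1,3) \<tau>0] by (simp add: \<tau>_def[abs_def] algebra_simps)
    also have "\<dots> = integral {c'..d'} (\<lambda>x. h x * \<psi> x) - integral {c'..d'} (\<lambda>x. k * (h x * \<rho> x))"
      using ai[OF \<psi> cd'(1,3)] ai[OF \<rho>(1) cd'(1,3)]
      by (intro integral_diff integrable_on_mult_right) (auto intro: set_lebesgue_integral_eq_integral(1))
    also have "\<dots> = I \<psi> - k * I \<rho>"
      using I[OF \<psi> cd'(1,3) \<psi>0] I[OF \<rho>(1) cd'(1,3) \<rho>0] by simp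
    finally show ?thesis by (simp add: k_def m_def field_simps)
  qed
  show ?thesis
  proof (rule that)
    fix c d assume cd: "a < c" "c \<le> d" "d < b"
    have eq: "integral {c..d} (\<lambda>x. trapezoid c d n x * h x) = m * integral {c..d} (\<lambda>x. trapezoid c d n x * 1)" for n
    proof -
      have out: "trapezoid c d n x = 0" if "x \<notin> {c..d}" for x
        using that by (intro trapezoid_outside) auto
      show ?thesis
        using key[OF trapezoid_continuous cd out] I[OF trapezoid_continuous cd(1,3) out]
        by (simp add: mult.commute)
    qed
    have lim: "(\<lambda>n. integral {c..d} (\<lambda>x. trapezoid c d n x * h x)) \<longlonglongrightarrow> integral {c..d} h"
      by (intro integral_trapezoid_mult_tendsto locally_integrable_subinterval[OF h] cd)
    have "(\<lambda>n. m * integral {c..d} (\<lambda>x. trapezoid c d n x * 1)) \<longlonglongrightarrow> m * integral {c..d} (\<lambda>_. 1)"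
      by (intro tendsto_intros integral_trapezoid_mult_tendsto absolutely_integrable_continuous_real) simp
    then have "integral {c..d} h = m * integral {c..d} (\<lambda>_. 1)"
      by (intro LIMSEQ_unique[OF lim]) (simp only: eq)
    then show "integral {c..d} h = m * (d - c)" using cd by simp
  qed
qed

text \<open>A primitive \<open>G\<close> of \<open>g\<close> has the same weak derivative as \<open>u\<close>, so the previous lemma applies
to \<open>u - G\<close>. Equality of integrals is all that is needed later: it implies pointwise equality
when \<open>u\<close> is continuous, and otherwise the integral of \<open>u\<close> may be replaced by that of the
continuous \<open>U\<close>.\<close>

lemma weak_deriv_imp_primitive:
  assumes w: "has_weak_deriv a b u g" and "a < b"
  obtains U where "primitive_on {a<..<b} U g"
    "\<And>c d. a < c \<Longrightarrow> d < b \<Longrightarrow> integral {c..d} u = integral {c..d} U"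
proof -
  define p where "p = (a + b) / 2"
  have p: "a < p" "p < b" using \<open>a < b\<close> by (auto simp: p_def)
  have u: "locally_integrable a b u" and g: "locally_integrable a b g"
    using w by (auto simp: has_weak_deriv_def)
  define G where "G x = (if p \<le> x then integral {p..x} g else - integral {x..p} g)" for x
  have gi: "g integrable_on {c..d}" if "a < c" "d < b" for c d
    by (intro set_lebesgue_integral_eq_integral(1) locally_integrable_subinterval[OF g that])
  have G: "primitive_on {a<..<b} G g"
    unfolding primitive_on_def
  proof (intro ballI impI conjI)
    fix c d assume cd: "c \<in> {a<..<b}" "d \<in> {a<..<b}" "c \<le> d"
    then show "g absolutely_integrable_on {c..d}"
      by (intro locally_integrable_subinterval[OF g]) auto
    consider "p \<le> c" | "c < p" "p \<le> d" | "d < p" by linarith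
    then show "G d - G c = integral {c..d} g"
    proof cases
      case 1
      then show ?thesis
        using Henstock_Kurzweil_Integration.integral_combine[of p c d g] gi[of p d] cd p by (simp add: G_def)
    next
      case 2
      then show ?thesis
        using Henstock_Kurzweil_Integration.integral_combine[of c p d g] gi[of c d] cd p by (simp add: G_def)
    next
      case 3
      then show ?thesis
        using Henstock_Kurzweil_Integration.integral_combine[of c d p g] gi[of c p] cd p by (simp add: G_def)
    qed
  qed
  note Gw = primitive_on_imp_weak_deriv[OF G \<open>a < b\<close>]
  have Gl: "locally_integrable a b G" using Gw by (simp add: has_weak_deriv_def)
  have diffl: "locally_integrable a b (\<lambda>x. u x - G x)"
    using u Gl unfolding locally_integrable_def by (auto intro: set_integral_diff(1))
  have "(LINT x|lebesgue_on {a<..<b}. (u x - G x) * deriv \<phi> x) = 0" if t: "test_function a b \<phi>" for \<phi>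
  proof -
    obtain c d where cd: "a < c" "c < d" "d < b" "\<And>x. x \<notin> {c..d} \<Longrightarrow> deriv \<phi> x = 0"
      "continuous_on UNIV (deriv \<phi>)"
      using test_function_support[OF t \<open>a < b\<close>] by metis
    have sub: "{c..d} \<subseteq> {a<..<b}" using cd by auto
    have ai: "(\<lambda>x. F x * deriv \<phi> x) absolutely_integrable_on {c..d}" if "locally_integrable a b F" for F
      using absolutely_integrable_continuous_mult[OF continuous_on_subset[OF cd(5)] locally_integrable_subinterval[OF that cd(1,3)]]
      by (simp add: mult.commute)
    have int: "(LINT x|lebesgue_on {a<..<b}. F x * deriv \<phi> x) = integral {c..d} (\<lambda>x. F x * deriv \<phi> x)"
      if "locally_integrable a b F" for F
      using that cd by (intro LINT_lebesgue_on_eq_integral_of_support ai sub) auto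
    have "integral {c..d} (\<lambda>x. u x * deriv \<phi> x) = integral {c..d} (\<lambda>x. G x * deriv \<phi> x)"
      using w Gw t int[OF u] int[OF Gl] by (simp add: has_weak_deriv_def)
    moreover have "integral {c..d} (\<lambda>x. u x * deriv \<phi> x - G x * deriv \<phi> x) =
        integral {c..d} (\<lambda>x. u x * deriv \<phi> x) - integral {c..d} (\<lambda>x. G x * deriv \<phi> x)"
      using ai[OF u] ai[OF Gl] by (intro integral_diff) (auto intro: set_lebesgue_integral_eq_integral(1))
    ultimately show ?thesis using int[OF diffl] by (simp add: left_diff_distrib)
  qed
  from integral_eq_if_weak_deriv_zero[OF diffl \<open>a < b\<close> this]
  obtain m where m: "\<And>c d. a < c \<Longrightarrow> c \<le> d \<Longrightarrow> d < b \<Longrightarrow> integral {c..d} (\<lambda>x. u x - G x) = m * (d - c)"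
    by metis
  show ?thesis
  proof (rule that[of "\<lambda>x. G x + m"])
    show "primitive_on {a<..<b} (\<lambda>x. G x + m) g"
      using G by (simp add: primitive_on_def)
    fix c d assume "a < c" "d < b"
    show "integral {c..d} u = integral {c..d} (\<lambda>x. G x + m)"
    proof (cases "c \<le> d")
      case True
      have "u integrable_on {c..d}" "G integrable_on {c..d}"
        using \<open>a < c\<close> \<open>d < b\<close> by (auto intro!: set_lebesgue_integral_eq_integral(1) locally_integrable_subinterval u Gl)
      then show ?thesis using m[OF \<open>a < c\<close> True \<open>d < b\<close>] True
        by (subst integral_add) (auto simp: integral_diff mult.commute)
    qed simp
  qed
qed

section \<open>The Lebesgue spaces\<close>

lemma Lp_space_measurable: "f \<in> Lp_space p S \<Longrightarrow> f \<in> borel_measurable (lebesgue_on S)"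
  by (simp add: Lp_space_def)

lemma integrable_lebesgue_on_subset:
  fixes f :: "real \<Rightarrow> real"
  assumes "integrable (lebesgue_on S) f" "S \<in> sets lebesgue" "T \<in> sets lebesgue" "T \<subseteq> S"
  shows "integrable (lebesgue_on T) f"
proof -
  have "set_integrable lebesgue S f"
    using assms by (simp add: set_integrable_def integrable_restrict_space)
  then have "set_integrable lebesgue T f"
    using assms by (rule_tac set_integrable_subset) auto
  then show ?thesis
    using assms by (simp add: set_integrable_def integrable_restrict_space)
qed

lemma AE_lebesgue_on_subset:
  assumes "AE x in lebesgue_on S. P x" "S \<in> sets lebesgue" "T \<in> sets lebesgue" "T \<subseteq> S"
  shows "AE x in lebesgue_on T. P x"
proof -
  have "AE x in lebesgue. x \<in> S \<longrightarrow> P x"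
    using assms by (simp add: AE_restrict_space_iff)
  then have "AE x in lebesgue. x \<in> T \<longrightarrow> P x"
    by eventually_elim (use assms in auto)
  then show ?thesis using assms by (simp add: AE_restrict_space_iff)
qed

lemma Lp_space_infinity_AE_bounded:
  assumes "f \<in> Lp_space \<infinity> S"
  obtains M where "0 \<le> M" "AE x in lebesgue_on S. \<bar>f x\<bar> \<le> M"
proof -
  let ?E = "esssup (lebesgue_on S) (\<lambda>x. ereal \<bar>f x\<bar>)"
  have "?E < \<infinity>" using assms by (simp add: Lp_space_def)
  then obtain M0 where M0: "?E \<le> ereal M0"
    by (cases ?E) auto
  have "AE x in lebesgue_on S. ereal \<bar>f x\<bar> \<le> ?E" by (rule esssup_AE)
  then have "AE x in lebesgue_on S. \<bar>f x\<bar> \<le> max 0 M0"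
  proof eventually_elim
    case (elim x)
    then have "ereal \<bar>f x\<bar> \<le> ereal M0" using M0 by (rule order_trans)
    then show ?case by simp
  qed
  then show ?thesis by (rule that[rotated]) simp
qed

text \<open>On intervals away from 0, the solution and its weak derivatives are each a bounded function plus a
bounded multiple of \<open>f\<close>.\<close>

lemma Lp_space_if_bounded_by:
  assumes f: "f \<in> Lp_space p S" and p: "1 \<le> p"
    and ST: "S \<in> sets lebesgue" "T \<in> lmeasurable" "T \<subseteq> S"
    and g: "g \<in> borel_measurable (lebesgue_on T)" "\<And>x. x \<in> T \<Longrightarrow> \<bar>g x\<bar> \<le> C * (1 + \<bar>f x\<bar>)"
    and "0 \<le> C"
  shows "g \<in> Lp_space p T"
proof (cases "p = \<infinity>")
  case True
  obtain M where M: "0 \<le> M" "AE x in lebesgue_on S. \<bar>f x\<bar> \<le> M"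
    using Lp_space_infinity_AE_bounded f True by auto
  have "AE x in lebesgue_on T. \<bar>f x\<bar> \<le> M"
    by (rule AE_lebesgue_on_subset[OF M(2)]) (use ST in auto)
  moreover have "AE x in lebesgue_on T. x \<in> T" by (auto intro!: AE_I2)
  ultimately have "AE x in lebesgue_on T. ereal \<bar>g x\<bar> \<le> ereal (C * (1 + M))"
  proof eventually_elim
    case (elim x)
    have "\<bar>g x\<bar> \<le> C * (1 + \<bar>f x\<bar>)" using g elim by blast
    also have "\<dots> \<le> C * (1 + M)" using elim \<open>0 \<le> C\<close> by (intro mult_left_mono) auto
    finally show ?case by simp
  qed
  then have "esssup (lebesgue_on T) (\<lambda>x. ereal \<bar>g x\<bar>) \<le> ereal (C * (1 + M))"
    using g by (intro esssup_I) auto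
  also have "\<dots> < \<infinity>" by simp
  finally show ?thesis using g True by (simp add: Lp_space_def)
next
  case False
  define q where "q = real_of_ereal p"
  have q: "1 \<le> q" "p = ereal q" using p False by (cases p; auto simp: q_def)+
  have fi: "integrable (lebesgue_on S) (\<lambda>x. \<bar>f x\<bar> powr q)"
    using f False by (simp add: Lp_space_def q_def)
  have "integrable (lebesgue_on T) (\<lambda>x. \<bar>f x\<bar> powr q)"
    by (rule integrable_lebesgue_on_subset[OF fi]) (use ST in auto)
  moreover have "integrable (lebesgue_on T) (\<lambda>_. 1::real)"
    using ST by (simp add: finite_measure_lebesgue_on finite_measure.integrable_const)
  ultimately have "integrable (lebesgue_on T) (\<lambda>x. (2 * C) powr q * (1 + \<bar>f x\<bar> powr q))"
    by (intro integrable_mult_right Bochner_Integration.integrable_add)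
  then have "integrable (lebesgue_on T) (\<lambda>x. \<bar>g x\<bar> powr q)"
  proof (rule Bochner_Integration.integrable_bound)
    show "(\<lambda>x. \<bar>g x\<bar> powr q) \<in> borel_measurable (lebesgue_on T)" using g by measurable
    show "AE x in lebesgue_on T. norm (\<bar>g x\<bar> powr q) \<le> norm ((2 * C) powr q * (1 + \<bar>f x\<bar> powr q))"
    proof (rule AE_I2)
      fix x assume "x \<in> space (lebesgue_on T)"
      then have "x \<in> T" by simp
      have "\<bar>g x\<bar> \<le> C * (1 + \<bar>f x\<bar>)" by (rule g) fact
      also have "\<dots> \<le> C * (2 * max 1 \<bar>f x\<bar>)" using \<open>0 \<le> C\<close> by (intro mult_left_mono) auto
      finally have "\<bar>g x\<bar> powr q \<le> (2 * C * max 1 \<bar>f x\<bar>) powr q"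
        using q by (intro powr_mono2) auto
      also have "\<dots> = (2 * C) powr q * (max 1 \<bar>f x\<bar>) powr q"
        using \<open>0 \<le> C\<close> by (simp add: powr_mult)
      also have "\<dots> \<le> (2 * C) powr q * (1 + \<bar>f x\<bar> powr q)"
        by (intro mult_left_mono) (auto simp: max_def)
      finally show "norm (\<bar>g x\<bar> powr q) \<le> norm ((2 * C) powr q * (1 + \<bar>f x\<bar> powr q))" by simp
    qed
  qed
  then show ?thesis using g False by (simp add: Lp_space_def q_def)
qed

lemma Lp_space_imp_absolutely_integrable:
  assumes f: "f \<in> Lp_space p {a<..<b}" and p: "1 \<le> p"
  shows "f absolutely_integrable_on {a..b}"
proof -
  have "integrable (lebesgue_on {a<..<b}) f"
  proof (cases "p = \<infinity>")
    case True
    obtain M where M: "0 \<le> M" "AE x in lebesgue_on {a<..<b}. \<bar>f x\<bar> \<le> M"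
      using Lp_space_infinity_AE_bounded f True by auto
    have "integrable (lebesgue_on {a<..<b}) (\<lambda>_. M)"
      by (simp add: finite_measure_lebesgue_on finite_measure.integrable_const)
    then show ?thesis
      by (rule Bochner_Integration.integrable_bound) (use f M in \<open>auto simp: Lp_space_def\<close>)
  next
    case False
    define q where "q = real_of_ereal p"
    have q: "1 \<le> q" "p = ereal q" using p False by (cases p; auto simp: q_def)+
    have "integrable (lebesgue_on {a<..<b}) (\<lambda>x. \<bar>f x\<bar> powr q)"
      using f False by (simp add: Lp_space_def q_def)
    moreover have "integrable (lebesgue_on {a<..<b}) (\<lambda>_. 1::real)"
      by (simp add: finite_measure_lebesgue_on finite_measure.integrable_const)
    ultimately have "integrable (lebesgue_on {a<..<b}) (\<lambda>x. 1 + \<bar>f x\<bar> powr q)"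
      by (intro Bochner_Integration.integrable_add)
    then show ?thesis
    proof (rule Bochner_Integration.integrable_bound)
      have "\<bar>f x\<bar> \<le> 1 + \<bar>f x\<bar> powr q" for x
      proof (cases "\<bar>f x\<bar> \<le> 1")
        case False
        then have "\<bar>f x\<bar> powr 1 \<le> \<bar>f x\<bar> powr q" using q by (intro powr_mono) auto
        then show ?thesis using False by simp
      qed (simp add: add_increasing2)
      then show "AE x in lebesgue_on {a<..<b}. norm (f x) \<le> norm (1 + \<bar>f x\<bar> powr q)"
        by (auto intro!: AE_I2)
    qed (use f in \<open>auto simp: Lp_space_def\<close>)
  qed
  then have "f absolutely_integrable_on {a<..<b}"
    by (simp add: integrable_restrict_space set_integrable_def)
  then show ?thesis
    using absolutely_integrable_on_open_interval[where f = f and a = a and b = b] by simp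
qed

text \<open>This takes the place of Hoelder's inequality and treats all exponents alike. For finite \<open>p\<close>
split at the level \<open>\<lambda> = x powr (- r)\<close>: either \<open>\<bar>f s\<bar> \<le> \<lambda>\<close>, or
\<open>\<bar>f s\<bar> \<le> \<lambda> powr (1 - p) * \<bar>f s\<bar> powr p\<close>, and
\<open>\<lambda> powr (1 - p) = x powr (1 - r)\<close>. For \<open>p = \<infinity>\<close> the level is 1 and the first
alternative always holds.\<close>

lemma weighted_integral_le_of_Lp_norm_le_1:
  assumes f: "f \<in> Lp_space p {0<..<1}" "Lp_norm p {0<..<1} f \<le> 1" and p: "1 \<le> p"
    and x: "0 < x" and ab: "0 \<le> a" "a \<le> b" "b \<le> 1"
    and w: "continuous_on {a..b} w" "\<And>s. s \<in> {a..b} \<Longrightarrow> 0 \<le> w s \<and> w s \<le> K"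
  defines "r \<equiv> real_of_ereal (1 / p)"
  shows "integral {a..b} (\<lambda>s. w s * \<bar>f s\<bar>) \<le> x powr (- r) * integral {a..b} w + x powr (1 - r) * K"
proof -
  let ?M = "lebesgue_on {0<..<1::real}" and ?N = "lebesgue_on {a<..<b}"
  have "0 \<le> K" using w(2)[of a] ab by auto
  obtain h where h: "integrable ?M h" "\<And>s. 0 \<le> h s" "integral\<^sup>L ?M h \<le> 1"
    and fh: "AE s in ?M. \<bar>f s\<bar> \<le> x powr (- r) + x powr (1 - r) * h s"
  proof (cases "p = \<infinity>")
    case True
    let ?E = "esssup ?M (\<lambda>x. ereal \<bar>f x\<bar>)"
    have "?E < \<infinity>" "real_of_ereal ?E \<le> 1" using f True by (auto simp: Lp_space_def Lp_norm_def)
    then have E: "?E \<le> 1" by (cases ?E) auto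
    have "AE s in ?M. ereal \<bar>f s\<bar> \<le> ?E" by (rule esssup_AE)
    then have "AE s in ?M. \<bar>f s\<bar> \<le> x powr (- r) + x powr (1 - r) * 0"
    proof eventually_elim
      case (elim s)
      then have "ereal \<bar>f s\<bar> \<le> 1" using E by (rule order_trans)
      then show ?case using x True by (simp add: r_def)
    qed
    then show ?thesis by (intro that[of "\<lambda>_. 0"]) auto
  next
    case False
    define q where "q = real_of_ereal p"
    have q: "1 \<le> q" "p = ereal q" using p False by (cases p; auto simp: q_def)+
    have r: "r = 1 / q" using q by (simp add: r_def one_ereal_def)
    define h where "h s = \<bar>f s\<bar> powr q" for s
    have hi: "integrable ?M h" unfolding h_def using f False by (simp add: Lp_space_def q_def)
    have h0: "0 \<le> h s" for s by (simp add: h_def)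
    have "integral\<^sup>L ?M h powr (1 / q) \<le> 1"
      using f(2) False by (simp add: Lp_norm_def q_def h_def[abs_def])
    then have "integral\<^sup>L ?M h \<le> 1"
    proof (rule contrapos_pp)
      assume "\<not> integral\<^sup>L ?M h \<le> 1"
      then show "\<not> integral\<^sup>L ?M h powr (1 / q) \<le> 1"
        using \<open>1 \<le> q\<close> gr_one_powr[of "integral\<^sup>L ?M h" "1 / q"] by (simp add: not_le)
    qed
    moreover have "\<bar>f s\<bar> \<le> x powr (- r) + x powr (1 - r) * h s" for s
    proof (cases "\<bar>f s\<bar> \<le> x powr (- r)")
      case True
      moreover have "0 \<le> x powr (1 - r) * h s" using h0 by simp
      ultimately show ?thesis by linarith
    next
      case False
      moreover have "0 < x powr (- r)" using x by simp
      ultimately have pos: "0 < \<bar>f s\<bar>" by linarith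
      have "(x powr (1 - r)) = (x powr (- r)) powr (1 - q)"
        using q r by (simp add: powr_powr field_simps)
      moreover have "\<dots> \<ge> \<bar>f s\<bar> powr (1 - q)"
        using False q x by (intro powr_mono2') auto
      ultimately have "\<bar>f s\<bar> powr (1 - q) * \<bar>f s\<bar> powr q \<le> x powr (1 - r) * h s"
        unfolding h_def by (intro mult_right_mono) auto
      moreover have "\<bar>f s\<bar> powr (1 - q) * \<bar>f s\<bar> powr q = \<bar>f s\<bar>"
        using pos by (simp flip: powr_add)
      ultimately have "\<bar>f s\<bar> \<le> x powr (1 - r) * h s" by simp
      then show ?thesis by (simp add: add_increasing)
    qed
    ultimately show ?thesis by (intro that[of h] hi h0 AE_I2)
  qed
  have sub: "{a<..<b} \<subseteq> {0<..<1}" using ab by auto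
  have hN: "integrable ?N h" by (rule integrable_lebesgue_on_subset[OF h(1)]) (use sub in auto)
  have fhN: "AE s in ?N. \<bar>f s\<bar> \<le> x powr (- r) + x powr (1 - r) * h s"
    by (rule AE_lebesgue_on_subset[OF fh]) (use sub in auto)
  have openi: "F absolutely_integrable_on {a..b} \<Longrightarrow> integrable ?N F \<and> integral\<^sup>L ?N F = integral {a..b} F" for F :: "real \<Rightarrow> real"
  proof -
    assume "F absolutely_integrable_on {a..b}"
    then have "F absolutely_integrable_on {a<..<b}"
      using absolutely_integrable_on_open_interval[where f = F and a = a and b = b] by simp
    then have "integrable ?N F" by (simp add: integrable_restrict_space set_integrable_def)
    moreover from this have "integral\<^sup>L ?N F = integral {a..b} F"
      by (simp add: lebesgue_integral_eq_integral integral_open_interval_real)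
    ultimately show ?thesis by simp
  qed
  have fi: "f absolutely_integrable_on {a..b}"
    using absolutely_integrable_on_subinterval[OF Lp_space_imp_absolutely_integrable[OF f(1) p]] ab by auto
  then have fi': "(\<lambda>s. \<bar>f s\<bar>) absolutely_integrable_on {a..b}"
    using absolutely_integrable_norm[OF fi] by (simp add: o_def)
  have wf: "integrable ?N (\<lambda>s. w s * \<bar>f s\<bar>)" "integral\<^sup>L ?N (\<lambda>s. w s * \<bar>f s\<bar>) = integral {a..b} (\<lambda>s. w s * \<bar>f s\<bar>)"
    using openi[OF absolutely_integrable_continuous_mult[OF w(1) fi']] by auto
  have wi: "integrable ?N w" "integral\<^sup>L ?N w = integral {a..b} w"
    using openi[OF absolutely_integrable_continuous_real[OF w(1)]] by auto
  have "integral {a..b} (\<lambda>s. w s * \<bar>f s\<bar>) = integral\<^sup>L ?N (\<lambda>s. w s * \<bar>f s\<bar>)" by (simp add: wf)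
  also have "\<dots> \<le> integral\<^sup>L ?N (\<lambda>s. x powr (- r) * w s + x powr (1 - r) * K * h s)"
  proof (rule integral_mono_AE[OF wf(1)])
    show "integrable ?N (\<lambda>s. x powr (- r) * w s + x powr (1 - r) * K * h s)"
      using wi hN by (intro Bochner_Integration.integrable_add integrable_mult_right)
    have "AE s in ?N. s \<in> {a<..<b}" by (auto intro!: AE_I2)
    then show "AE s in ?N. w s * \<bar>f s\<bar> \<le> x powr (- r) * w s + x powr (1 - r) * K * h s"
      using fhN
    proof eventually_elim
      case (elim s)
      then have ws: "0 \<le> w s" "w s \<le> K" using w(2)[of s] by auto
      have "w s * \<bar>f s\<bar> \<le> w s * (x powr (- r) + x powr (1 - r) * h s)"
        using elim ws by (intro mult_left_mono) auto
      also have "\<dots> = x powr (- r) * w s + (x powr (1 - r) * h s) * w s" by (simp add: algebra_simps)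
      also have "\<dots> \<le> x powr (- r) * w s + (x powr (1 - r) * h s) * K"
        using ws h by (intro add_left_mono mult_left_mono) auto
      finally show ?case by (simp add: mult_ac)
    qed
  qed
  also have "\<dots> = x powr (- r) * integral {a..b} w + x powr (1 - r) * K * integral\<^sup>L ?N h"
    using wi hN by simp
  also have "integral\<^sup>L ?N h \<le> integral\<^sup>L ?M h"
  proof -
    have "integral\<^sup>L ?N h = (LINT s|?M. indicator {a<..<b} s * h s)"
    proof -
      have "integral\<^sup>L ?N h = (LINT s|lebesgue. indicator {a<..<b} s * h s)"
        by (simp add: integral_restrict_space)
      also have "\<dots> = (LINT s|lebesgue. indicator {0<..<1} s * (indicator {a<..<b} s * h s))"
        using sub by (intro Bochner_Integration.integral_cong) (auto simp: indicator_def)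
      also have "\<dots> = (LINT s|?M. indicator {a<..<b} s * h s)"
        by (simp add: integral_restrict_space)
      finally show ?thesis .
    qed
    also have "\<dots> \<le> integral\<^sup>L ?M h"
      using h by (intro integral_mono_AE' AE_I2) (auto simp: indicator_def)
    finally show ?thesis .
  qed
  then have "x powr (- r) * integral {a..b} w + x powr (1 - r) * K * integral\<^sup>L ?N h
      \<le> x powr (- r) * integral {a..b} w + x powr (1 - r) * K * 1"
    using h(3) \<open>0 \<le> K\<close> by (intro add_left_mono mult_left_mono) auto
  finally show ?thesis by simp
qed

section \<open>Uniqueness and a criterion for solutions\<close>

lemma continuous_eq_if_integrals_eq:
  fixes u w :: "real \<Rightarrow> real"
  assumes "continuous_on {a<..<b} u" "continuous_on {a<..<b} w"
    and eq: "\<And>c d. a < c \<Longrightarrow> d < b \<Longrightarrow> integral {c..d} u = integral {c..d} w"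
    and x: "x \<in> {a<..<b}"
  shows "u x = w x"
proof -
  have cont: "continuous_on {a<..<b} (\<lambda>x. u x - w x)" by (intro continuous_intros assms)
  have "primitive_on {a<..<b} (\<lambda>_. 0) (\<lambda>x. u x - w x)"
    unfolding primitive_on_def
  proof (intro ballI impI conjI)
    fix c d assume cd: "c \<in> {a<..<b}" "d \<in> {a<..<b}" "c \<le> d"
    then have sub: "{c..d} \<subseteq> {a<..<b}" by auto
    show "(\<lambda>x. u x - w x) absolutely_integrable_on {c..d}"
      by (intro absolutely_integrable_continuous_real continuous_on_subset[OF cont sub])
    have "integral {c..d} (\<lambda>x. u x - w x) = integral {c..d} u - integral {c..d} w"
      by (intro integral_diff integrable_continuous_real continuous_on_subset[OF _ sub] assms)
    then show "0 - 0 = integral {c..d} (\<lambda>x. u x - w x)" using eq[of c d] cd by simp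
  qed
  then have "((\<lambda>_. 0) has_real_derivative u x - w x) (at x)"
    by (rule primitive_on_DERIV) (use x cont in \<open>auto simp: is_interval_oo\<close>)
  moreover have "((\<lambda>_. 0) has_real_derivative 0) (at x)" by simp
  ultimately have "u x - w x = 0" by (rule DERIV_unique)
  then show ?thesis by simp
qed

lemma primitive_on_open_continuous:
  assumes "primitive_on {a<..<b} u g"
  shows "continuous_on {a<..<b} u"
proof (rule continuous_at_imp_continuous_on, rule ballI)
  fix x assume x: "x \<in> {a<..<b}"
  define c d where "c = (a + x) / 2" and "d = (x + b) / 2"
  have cd: "a < c" "c < x" "x < d" "d < b" using x by (auto simp: c_def d_def)
  have "continuous_on {c..d} u" using cd by (intro primitive_on_continuous[OF assms]) auto
  then have "continuous_on {c<..<d} u" by (rule continuous_on_subset) auto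
  then show "isCont u x" using cd by (simp add: continuous_on_eq_continuous_at)
qed

lemma DERIV_restrict:
  assumes "(u has_real_derivative D) (at x)" "0 < x" "x < 1"
  shows "(restrict u {0<..1} has_real_derivative D) (at x)"
proof -
  have "eventually (\<lambda>y. y \<in> {0<..<1}) (nhds x)" using assms by (intro eventually_nhds_in_open) auto
  then have "eventually (\<lambda>y. restrict u {0<..1} y = u y) (nhds x)" by eventually_elim auto
  then show ?thesis using assms(1) by (subst DERIV_cong_ev[OF refl _ refl]) auto
qed

text \<open>Applying the du Bois-Reymond argument once to \<open>u\<close> and once to its weak derivative shows that
\<open>u\<close> is continuously differentiable; applying it to the flux \<open>x powr (2 * \<alpha>) * deriv u x\<close>
turns the weak equation into an integral equation.\<close>

lemma neumann_solution_classical: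
  assumes "neumann_solution \<alpha> p f u"
  obtains v where
    "\<And>x. x \<in> {0<..<1} \<Longrightarrow> (u has_real_derivative deriv u x) (at x)"
    "primitive_on {0<..<1} (\<lambda>x. x powr (2 * \<alpha>) * deriv u x) v"
    "AE x in lebesgue_on {0<..1}. v x = u x - f x"
proof -
  obtain v where v: "has_weak_deriv 0 1 (\<lambda>x. x powr (2 * \<alpha>) * deriv u x) v"
      "AE x in lebesgue_on {0<..1}. - v x + u x = f x"
    and u: "continuous_on {0<..1} u" "u \<in> W2p_loc p"
    using assms by (auto simp: neumann_solution_def)
  have C1: "(u has_real_derivative deriv u x) (at x) \<and> isCont (deriv u) x" if x: "x \<in> {0<..<1}" for x
  proof -
    define \<delta> where "\<delta> = x / 2"
    have \<delta>: "0 < \<delta>" "\<delta> < x" "\<delta> < 1" using x by (auto simp: \<delta>_def)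
    then obtain g g' where g: "has_weak_deriv \<delta> 1 u g" "has_weak_deriv \<delta> 1 g g'"
      using u(2) unfolding W2p_loc_def W2p_def W1p_def by fastforce
    obtain U where U: "primitive_on {\<delta><..<1} U g"
      "\<And>c d. \<delta> < c \<Longrightarrow> d < 1 \<Longrightarrow> integral {c..d} u = integral {c..d} U"
      using weak_deriv_imp_primitive[OF g(1) \<delta>(3)] by metis
    obtain G where G: "primitive_on {\<delta><..<1} G g'"
      "\<And>c d. \<delta> < c \<Longrightarrow> d < 1 \<Longrightarrow> integral {c..d} g = integral {c..d} G"
      using weak_deriv_imp_primitive[OF g(2) \<delta>(3)] by metis
    have contG: "continuous_on {\<delta><..<1} G" by (rule primitive_on_open_continuous[OF G(1)])
    have uU: "u y = U y" if "y \<in> {\<delta><..<1}" for y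
      using \<delta> by (intro continuous_eq_if_integrals_eq[OF _ primitive_on_open_continuous[OF U(1)] U(2) that])
        (auto intro: continuous_on_subset[OF u(1)])
    have "primitive_on {\<delta><..<1} u G"
      unfolding primitive_on_def
    proof (intro ballI impI conjI)
      fix c d assume cd: "c \<in> {\<delta><..<1}" "d \<in> {\<delta><..<1}" "c \<le> d"
      show "G absolutely_integrable_on {c..d}"
        using cd by (intro absolutely_integrable_continuous_real continuous_on_subset[OF contG]) auto
      have "u d - u c = integral {c..d} g" using primitive_onD(3)[OF U(1) cd] cd uU by simp
      then show "u d - u c = integral {c..d} G" using G(2)[of c d] cd by simp
    qed
    from primitive_on_DERIV[OF this _ contG]
    have D: "(u has_real_derivative G y) (at y)" if "y \<in> {\<delta><..<1}" for y
      using that by (auto simp: is_interval_oo)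
    then have dG: "deriv u y = G y" if "y \<in> {\<delta><..<1}" for y
      using that by (auto intro: DERIV_imp_deriv)
    have "continuous_on {\<delta><..<1} (deriv u)"
      using contG by (rule continuous_on_eq) (simp add: dG)
    then have "isCont (deriv u) x" using x \<delta> by (simp add: continuous_on_eq_continuous_at)
    then show ?thesis using D[of x] dG[of x] x \<delta> by simp
  qed
  define z where "z x = x powr (2 * \<alpha>) * deriv u x" for x
  have contz: "continuous_on {0<..<1} z"
    unfolding z_def using C1
    by (intro continuous_intros continuous_at_imp_continuous_on) auto
  obtain Z where Z: "primitive_on {0<..<1} Z v"
      "\<And>c d. 0 < c \<Longrightarrow> d < 1 \<Longrightarrow> integral {c..d} z = integral {c..d} Z"
    using weak_deriv_imp_primitive[OF v(1)] by (auto simp: z_def[abs_def])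
  have "z x = Z x" if "x \<in> {0<..<1}" for x
    using that by (intro continuous_eq_if_integrals_eq[OF contz primitive_on_open_continuous[OF Z(1)] Z(2)]) auto
  then have "primitive_on {0<..<1} z v"
    by (intro primitive_on_cong[OF Z(1)]) (auto simp: is_interval_oo)
  moreover have "AE x in lebesgue_on {0<..1}. v x = u x - f x"
    using v(2) by eventually_elim auto
  ultimately show ?thesis using C1 that by (auto simp: z_def[abs_def])
qed

text \<open>Here \<open>\<zeta>\<close> is the flux and \<open>k\<close> stands for \<open>2 * \<alpha>\<close>. The product \<open>\<zeta> * w\<close>
has the derivative \<open>w\<^sup>2 + x powr (- k) * \<zeta>\<^sup>2\<close> and tends to 0 at 1, so it is nonpositive.
Since \<open>2 * \<zeta> * w\<close> is the derivative of \<open>\<zeta>\<^sup>2\<close>, the latter decreases; it tends to 0 at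
the left end, hence vanishes, and \<open>w\<close> is the derivative of \<open>\<zeta>\<close>.\<close>

lemma homogeneous_neumann_solution_zero:
  fixes w \<zeta> :: "real \<Rightarrow> real"
  assumes w: "\<And>x. x \<in> {0<..<1} \<Longrightarrow> (w has_real_derivative x powr (- k) * \<zeta> x) (at x)"
    and \<zeta>: "\<And>x. x \<in> {0<..<1} \<Longrightarrow> (\<zeta> has_real_derivative w x) (at x)"
    and cont: "continuous_on {0<..1} w" and "w 1 = 0" and lim0: "(\<zeta> \<longlongrightarrow> 0) (at_right 0)"
    and x: "x \<in> {0<..1}"
  shows "w x = 0"
proof -
  define P where "P x = \<zeta> x * w x" for x
  have P: "(P has_real_derivative (w x)\<^sup>2 + x powr (- k) * (\<zeta> x)\<^sup>2) (at x)" if "x \<in> {0<..<1}" for x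
    unfolding P_def by (rule derivative_eq_intros w \<zeta> that)+ (simp add: power2_eq_square)
  have Pmono: "P s \<le> P t" if "0 < s" "s \<le> t" "t < 1" for s t
    using that by (intro DERIV_nonneg_imp_nondecreasing[of s t P]) (auto intro!: exI P)
  have lim1: "(w \<longlongrightarrow> 0) (at_left 1)"
  proof -
    have "(w \<longlongrightarrow> w 1) (at 1 within {0<..1})" using cont by (auto simp: continuous_on_def)
    then have "(w \<longlongrightarrow> w 1) (at 1 within {0<..<1})" by (rule tendsto_within_subset) auto
    moreover have "at 1 within {0<..<1} = at_left (1::real)" 
      by (rule at_within_nhd[where S = "{0<..}"]) auto
    ultimately show ?thesis using \<open>w 1 = 0\<close> by simp
  qed
  have limP: "(P \<longlongrightarrow> 0) (at_left 1)"
  proof -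
    have "compact {1/2..1::real}" "continuous_on {1/2..1} w"
      using cont by (auto intro: continuous_on_subset)
    then have "bounded (w ` {1/2..1})" using compact_continuous_image compact_imp_bounded by blast
    then obtain B where "\<forall>y\<in>w ` {1/2..1}. norm y \<le> B" unfolding bounded_iff by blast
    then have B: "\<bar>w x\<bar> \<le> B" if "x \<in> {1/2..1}" for x using that by auto
    have bd: "\<bar>\<zeta> x\<bar> \<le> \<bar>\<zeta> (1/2)\<bar> + B" if "x \<in> {1/2<..<1}" for x
    proof -
      have "\<exists>y>1/2. y < x \<and> \<zeta> x - \<zeta> (1/2) = (x - 1/2) * w y"
        using that by (intro MVT2 \<zeta>) auto
      then obtain y where y1: "1/2 < y" "y < x" and y: "\<zeta> x - \<zeta> (1/2) = (x - 1/2) * w y"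
        by blast
      have "\<bar>w y\<bar> \<le> B" by (rule B) (use y1 that in simp)
      then have "\<bar>x - 1/2\<bar> * \<bar>w y\<bar> \<le> 1 * B" using that by (intro mult_mono) auto
      then show ?thesis using y unfolding abs_mult[symmetric] by linarith
    qed
    have ev: "eventually (\<lambda>x. x \<in> {1/2<..<1::real}) (at_left 1)" by (intro eventually_at_left_real) simp
    have "((\<lambda>x. (\<bar>\<zeta> (1/2)\<bar> + B) * \<bar>w x\<bar>) \<longlongrightarrow> (\<bar>\<zeta> (1/2)\<bar> + B) * \<bar>0\<bar>) (at_left 1)"
      by (intro tendsto_intros lim1)
    then have "((\<lambda>x. (\<bar>\<zeta> (1/2)\<bar> + B) * \<bar>w x\<bar>) \<longlongrightarrow> 0) (at_left 1)" by simp
    moreover have "eventually (\<lambda>x. norm (P x) \<le> (\<bar>\<zeta> (1/2)\<bar> + B) * \<bar>w x\<bar>) (at_left 1)"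
      using ev by eventually_elim (auto simp: P_def abs_mult intro!: mult_right_mono bd)
    ultimately show ?thesis by (rule Lim_null_comparison[rotated])
  qed
  have Pneg: "P s \<le> 0" if "s \<in> {0<..<1}" for s
  proof (rule tendsto_lowerbound[OF limP])
    have "eventually (\<lambda>x. x \<in> {s<..<1}) (at_left 1)" using that by (intro eventually_at_left_real) simp
    then show "eventually (\<lambda>x. P s \<le> P x) (at_left 1)" 
      by eventually_elim (use that in \<open>auto intro: Pmono\<close>)
  qed simp
  have \<zeta>0: "\<zeta> s = 0" if s: "s \<in> {0<..<1}" for s
  proof -
    have anti: "(\<zeta> s)\<^sup>2 \<le> (\<zeta> t)\<^sup>2" if "0 < t" "t \<le> s" for t
    proof (rule DERIV_nonpos_imp_nonincreasing[OF \<open>t \<le> s\<close>])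
      fix y assume y: "t \<le> y" "y \<le> s"
      then have y': "y \<in> {0<..<1}" using that s by auto
      have "((\<lambda>y. (\<zeta> y)\<^sup>2) has_real_derivative 2 * P y) (at y)"
        by (rule derivative_eq_intros \<zeta> y')+ (simp add: P_def)
      then show "\<exists>z. ((\<lambda>y. (\<zeta> y)\<^sup>2) has_real_derivative z) (at y) \<and> z \<le> 0"
        using Pneg[OF y'] by (intro exI[of _ "2 * P y"]) auto
    qed
    have "((\<lambda>t. (\<zeta> t)\<^sup>2) \<longlongrightarrow> 0\<^sup>2) (at_right 0)" by (intro tendsto_intros lim0)
    moreover have "eventually (\<lambda>t. (\<zeta> s)\<^sup>2 \<le> (\<zeta> t)\<^sup>2) (at_right 0)"
    proof -
      have "eventually (\<lambda>t. t \<in> {0<..<s}) (at_right 0)" using s by (intro eventually_at_right_real) simp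
      then show ?thesis by eventually_elim (auto intro: anti)
    qed
    ultimately have "(\<zeta> s)\<^sup>2 \<le> 0\<^sup>2" by (rule tendsto_lowerbound) simp
    then show ?thesis by simp
  qed
  show ?thesis
  proof (cases "x = 1")
    case False
    then have x': "x \<in> {0<..<1}" using x by auto
    have "eventually (\<lambda>y. y \<in> {0<..<1}) (nhds x)" using x' by (intro eventually_nhds_in_open) auto
    then have "eventually (\<lambda>y. \<zeta> y = 0) (nhds x)" by eventually_elim (rule \<zeta>0)
    then have "(\<zeta> has_real_derivative w x) (at x) \<longleftrightarrow> ((\<lambda>_. 0) has_real_derivative w x) (at x)"
      by (intro DERIV_cong_ev) auto
    then have "((\<lambda>_. 0) has_real_derivative w x) (at x)" using \<zeta>[OF x'] by simp
    then show ?thesis by (metis DERIV_const DERIV_unique)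
  qed (use \<open>w 1 = 0\<close> in simp)
qed

text \<open>In the difference of two solutions the datum \<open>f\<close> cancels, so the density of the flux is
continuous and the difference solves the homogeneous equation classically.\<close>

lemma neumann_solution_unique:
  assumes 1: "neumann_solution \<alpha> p f u1" and 2: "neumann_solution \<alpha> p f u2"
  shows "u1 = u2"
proof -
  obtain v1 where v1: "\<And>x. x \<in> {0<..<1} \<Longrightarrow> (u1 has_real_derivative deriv u1 x) (at x)"
    "primitive_on {0<..<1} (\<lambda>x. x powr (2 * \<alpha>) * deriv u1 x) v1"
    "AE x in lebesgue_on {0<..1}. v1 x = u1 x - f x"
    using neumann_solution_classical[OF 1] by metis
  obtain v2 where v2: "\<And>x. x \<in> {0<..<1} \<Longrightarrow> (u2 has_real_derivative deriv u2 x) (at x)"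
    "primitive_on {0<..<1} (\<lambda>x. x powr (2 * \<alpha>) * deriv u2 x) v2"
    "AE x in lebesgue_on {0<..1}. v2 x = u2 x - f x"
    using neumann_solution_classical[OF 2] by metis
  define w where "w x = u1 x - u2 x" for x
  define \<zeta> where "\<zeta> x = x powr (2 * \<alpha>) * deriv u1 x - x powr (2 * \<alpha>) * deriv u2 x" for x
  have cont: "continuous_on {0<..1} w"
    unfolding w_def using 1 2 by (intro continuous_intros) (auto simp: neumann_solution_def)
  have prim: "primitive_on {0<..<1} \<zeta> (\<lambda>x. v1 x - v2 x)"
    unfolding \<zeta>_def by (intro primitive_on_diff v1 v2)
  have "AE x in lebesgue_on {0<..1}. v1 x - v2 x = w x"
    using v1(3) v2(3) by eventually_elim (simp add: w_def)
  then have ae: "AE x in lebesgue. x \<in> {0<..1} \<longrightarrow> v1 x - v2 x = w x"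
    by (simp add: AE_restrict_space_iff)
  then obtain N where N: "negligible N" "{x. \<not> (x \<in> {0<..1} \<longrightarrow> v1 x - v2 x = w x)} \<subseteq> N"
    unfolding eventually_ae_filter negligible_iff_null_sets by auto
  have "primitive_on {0<..<1} \<zeta> w"
    unfolding primitive_on_def
  proof (intro ballI impI conjI)
    fix c d assume cd: "c \<in> {0<..<1::real}" "d \<in> {0<..<1}" "c \<le> d"
    show "w absolutely_integrable_on {c..d}"
      using cd by (intro absolutely_integrable_continuous_real continuous_on_subset[OF cont]) auto
    have "integral {c..d} (\<lambda>x. v1 x - v2 x) = integral {c..d} w"
    proof (rule integral_spike[OF N(1)])
      show "w x = v1 x - v2 x" if "x \<in> {c..d} - N" for x
      proof -
        have "x \<in> {0<..1}" using that cd by auto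
        moreover have "\<not> \<not> (x \<in> {0<..1} \<longrightarrow> v1 x - v2 x = w x)" using that N(2) by blast
        ultimately show ?thesis by simp
      qed
    qed
    then show "\<zeta> d - \<zeta> c = integral {c..d} w" using primitive_onD(3)[OF prim cd] by simp
  qed
  moreover have "continuous_on {0<..<1} w" by (rule continuous_on_subset[OF cont]) auto
  ultimately have \<zeta>: "(\<zeta> has_real_derivative w x) (at x)" if "x \<in> {0<..<1}" for x
    using that by (intro primitive_on_DERIV) (auto simp: is_interval_oo)
  have w: "(w has_real_derivative x powr (- (2 * \<alpha>)) * \<zeta> x) (at x)" if x: "x \<in> {0<..<1}" for x
  proof -
    have "(w has_real_derivative deriv u1 x - deriv u2 x) (at x)"
      unfolding w_def by (intro derivative_intros v1 v2 x)
    moreover have "x powr (- (2 * \<alpha>)) * \<zeta> x = (x powr (- (2 * \<alpha>)) * x powr (2 * \<alpha>)) * (deriv u1 x - deriv u2 x)"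
      by (simp add: \<zeta>_def algebra_simps)
    moreover have "x powr (- (2 * \<alpha>)) * x powr (2 * \<alpha>) = 1"
      using x by (simp flip: powr_add)
    ultimately show ?thesis by simp
  qed
  have "w 1 = 0" using 1 2 by (simp add: w_def neumann_solution_def)
  have "((\<lambda>x. x powr (2 * \<alpha>) * deriv u1 x - x powr (2 * \<alpha>) * deriv u2 x) \<longlongrightarrow> 0 - 0) (at_right 0)"
    using 1 2 by (intro tendsto_diff) (auto simp: neumann_solution_def)
  then have "(\<zeta> \<longlongrightarrow> 0) (at_right 0)" by (simp add: \<zeta>_def[abs_def])
  then have "w x = 0" if "x \<in> {0<..1}" for x
    using homogeneous_neumann_solution_zero[OF w \<zeta> cont \<open>w 1 = 0\<close>] that by blast
  then show ?thesis
    using 1 2 by (intro extensionalityI[where A = "{0<..1}"]) (auto simp: neumann_solution_def w_def)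
qed

text \<open>The first-order system in \<open>u\<close> and the flux \<open>z\<close>, written with primitives, and the boundary
conditions are what is verified for a concrete solution; Sobolev regularity on \<open>{\<delta><..<1}\<close> follows because every
coefficient is bounded there.\<close>

lemma neumann_solutionI:
  assumes f: "f \<in> Lp_space p {0<..<1}" and p: "1 \<le> p"
    and u: "continuous_on {0<..1} u" and z: "continuous_on {0<..1} z"
    and uz: "primitive_on {0<..1} u (\<lambda>x. x powr (- 2 * \<alpha>) * z x)"
    and zu: "primitive_on {0<..1} z (\<lambda>x. u x - f x)"
    and bc: "u 1 = 0" "(z \<longlongrightarrow> 0) (at_right 0)"
  shows "neumann_solution \<alpha> p f (restrict u {0<..1})"
    and "\<And>x. x \<in> {0<..<1} \<Longrightarrow> deriv (restrict u {0<..1}) x = x powr (- 2 * \<alpha>) * z x"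
proof -
  let ?u = "restrict u {0<..1}"
  define g where "g x = x powr (- 2 * \<alpha>) * z x" for x
  define g' where "g' x = x powr (- 2 * \<alpha>) * (u x - f x) + z x * (- 2 * \<alpha> * x powr (- 2 * \<alpha> - 1))" for x
  have sub: "{0<..<1} \<subseteq> {0<..1::real}" by auto
  have contg: "continuous_on {0<..1} g" unfolding g_def by (intro continuous_intros z) auto
  have "(u has_real_derivative g x) (at x)" if "x \<in> {0<..<1}" for x
    using that by (intro primitive_on_DERIV[OF primitive_on_subset[OF uz[folded g_def] sub]]
        continuous_on_subset[OF contg]) (auto simp: is_interval_oo)
  then have D: "(?u has_real_derivative g x) (at x)" if "x \<in> {0<..<1}" for x
    using that by (intro DERIV_restrict) auto
  then have deriv: "deriv ?u x = g x" if "x \<in> {0<..<1}" for x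
    using that by (intro DERIV_imp_deriv)
  then show "\<And>x. x \<in> {0<..<1} \<Longrightarrow> deriv (restrict u {0<..1}) x = x powr (- 2 * \<alpha>) * z x"
    by (simp add: g_def)
  have flux: "x powr (2 * \<alpha>) * deriv ?u x = z x" if "x \<in> {0<..<1}" for x
    using that by (simp add: deriv g_def flip: powr_add mult.assoc)
  have cont: "continuous_on {0<..1} ?u" using u by (rule continuous_on_eq) simp
  have "?u \<in> W2p p \<delta> 1" if \<delta>: "\<delta> \<in> {0<..<1}" for \<delta>
  proof -
    let ?S = "{\<delta><..<1}"
    have subS: "?S \<subseteq> {0<..1}" using \<delta> by auto
    have bdd: "\<exists>C\<ge>0. \<forall>x\<in>?S. \<bar>F x\<bar> \<le> C" if "continuous_on {0<..1} F" for F :: "real \<Rightarrow> real"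
    proof -
      have "continuous_on {\<delta>..1} F" using \<delta> by (intro continuous_on_subset[OF that]) auto
      then have "bounded (F ` {\<delta>..1})" by (intro compact_imp_bounded compact_continuous_image) auto
      then obtain C where "\<forall>x\<in>{\<delta>..1}. \<bar>F x\<bar> \<le> C" unfolding bounded_iff by auto
      then have "\<forall>x\<in>?S. \<bar>F x\<bar> \<le> \<bar>C\<bar>" using \<delta> by (metis abs_ge_self atLeastAtMost_iff greaterThanLessThan_iff less_imp_le order_trans)
      then show ?thesis by (intro exI[of _ "\<bar>C\<bar>"]) simp
    qed
    have meas: "F \<in> borel_measurable (lebesgue_on ?S)" if "continuous_on {0<..1} F" for F :: "real \<Rightarrow> real"
      by (intro continuous_imp_measurable_on_sets_lebesgue continuous_on_subset[OF that subS]) auto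
    have fmeas: "f \<in> borel_measurable (lebesgue_on ?S)"
      by (rule measurable_restrict_mono[OF Lp_space_measurable[OF f]]) (use \<delta> in auto)
    have Lp: "F \<in> Lp_space p ?S"
      if "F \<in> borel_measurable (lebesgue_on ?S)" "\<And>x. x \<in> ?S \<Longrightarrow> \<bar>F x\<bar> \<le> C * (1 + \<bar>f x\<bar>)" "0 \<le> C" for F C
      using \<delta> by (intro Lp_space_if_bounded_by[OF f p _ _ _ that]) auto
    have Lp_cont: "F \<in> Lp_space p ?S" if F: "continuous_on {0<..1} F" for F
    proof -
      obtain C where C: "C \<ge> 0" "\<forall>x\<in>?S. \<bar>F x\<bar> \<le> C" using bdd[OF F] by blast
      have "\<bar>F x\<bar> \<le> C * (1 + \<bar>f x\<bar>)" if "x \<in> ?S" for x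
        using C that mult_left_mono[of 1 "1 + \<bar>f x\<bar>" C] by fastforce
      then show ?thesis by (intro Lp[OF meas[OF F] _ C(1)])
    qed
    define F1 where "F1 x = x powr (- 2 * \<alpha>) * u x + z x * (- 2 * \<alpha> * x powr (- 2 * \<alpha> - 1))" for x
    define F2 where "F2 x = x powr (- 2 * \<alpha>)" for x :: real
    have F1: "continuous_on {0<..1} F1" unfolding F1_def by (intro continuous_intros u z) auto
    have F2: "continuous_on {0<..1} F2" unfolding F2_def by (intro continuous_intros) auto
    have g'F: "g' = (\<lambda>x. F1 x - F2 x * f x)" by (auto simp: g'_def F1_def F2_def algebra_simps)
    obtain C1 where C1: "C1 \<ge> 0" "\<forall>x\<in>?S. \<bar>F1 x\<bar> \<le> C1" using bdd[OF F1] by blast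
    obtain C2 where C2: "C2 \<ge> 0" "\<forall>x\<in>?S. \<bar>F2 x\<bar> \<le> C2" using bdd[OF F2] by blast
    have "g' \<in> Lp_space p ?S"
    proof (rule Lp)
      show "g' \<in> borel_measurable (lebesgue_on ?S)"
        unfolding g'F using meas[OF F1] meas[OF F2] fmeas by measurable
      fix x assume "x \<in> ?S"
      then have "\<bar>F1 x\<bar> \<le> C1" "\<bar>F2 x\<bar> * \<bar>f x\<bar> \<le> C2 * \<bar>f x\<bar>" 
        using C1 C2 by (auto intro!: mult_right_mono)
      then have "\<bar>g' x\<bar> \<le> C1 + C2 * \<bar>f x\<bar>" unfolding g'F abs_mult[symmetric] by linarith
      also have "\<dots> \<le> (C1 + C2) * (1 + \<bar>f x\<bar>)" using C1 C2 by (simp add: algebra_simps)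
      finally show "\<bar>g' x\<bar> \<le> (C1 + C2) * (1 + \<bar>f x\<bar>)" .
    qed (use C1 C2 in simp)
    moreover have "primitive_on {0<..1} g g'"
    proof -
      have "primitive_on {0<..1} (\<lambda>x. x powr (- 2 * \<alpha>)) (\<lambda>x. - 2 * \<alpha> * x powr (- 2 * \<alpha> - 1))"
        by (intro primitive_on_if_has_derivative) 
          (auto intro!: derivative_eq_intros continuous_intros simp: is_interval_oc)
      from primitive_on_mult[OF this zu] show ?thesis 
        unfolding g_def g'_def by (simp add: is_interval_oc)
    qed
    then have "has_weak_deriv \<delta> 1 g g'"
      using \<delta> by (intro primitive_on_imp_weak_deriv primitive_on_subset[OF _ subS]) auto
    ultimately have "g \<in> W1p p \<delta> 1" using Lp_cont[OF contg] by (auto simp: W1p_def)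
    moreover have "primitive_on {0<..1} ?u g"
      by (rule primitive_on_cong[OF uz]) (auto simp: is_interval_oc g_def)
    then have "has_weak_deriv \<delta> 1 ?u g"
      using \<delta> by (intro primitive_on_imp_weak_deriv primitive_on_subset[OF _ subS]) auto
    ultimately show ?thesis using Lp_cont[OF cont] by (auto simp: W2p_def)
  qed
  then have W2: "?u \<in> W2p_loc p" by (simp add: W2p_loc_def)
  have "primitive_on {0<..<1} (\<lambda>x. x powr (2 * \<alpha>) * deriv ?u x) (\<lambda>x. u x - f x)"
    by (rule primitive_on_cong[OF primitive_on_subset[OF zu sub]]) (auto simp: is_interval_oo flux)
  then have weak: "has_weak_deriv 0 1 (\<lambda>x. x powr (2 * \<alpha>) * deriv ?u x) (\<lambda>x. u x - f x)"
    by (intro primitive_on_imp_weak_deriv) auto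
  have eq: "AE x in lebesgue_on {0<..1}. - (u x - f x) + ?u x = f x"
    by (intro AE_I2) auto
  have "eventually (\<lambda>x. x \<in> {0<..<1::real}) (at_right 0)" by (intro eventually_at_right_real) simp
  then have "eventually (\<lambda>x. z x = x powr (2 * \<alpha>) * deriv ?u x) (at_right 0)"
    by eventually_elim (simp add: flux)
  then have lim: "((\<lambda>x. x powr (2 * \<alpha>) * deriv ?u x) \<longlongrightarrow> 0) (at_right 0)"
    using bc(2) by (rule Lim_transform_eventually[rotated])
  show "neumann_solution \<alpha> p f ?u"
    unfolding neumann_solution_def using cont W2 weak eq bc(1) lim by (auto simp del: restrict_apply) (auto)
qed

lemma u_N_eq:
  assumes "neumann_solution \<alpha> p f u"
  shows "u_N \<alpha> p f = u"
  unfolding u_N_def using assms neumann_solution_unique by blast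

section \<open>A fundamental system of the homogeneous equation\<close>

text \<open>With \<open>t = x powr \<beta>\<close> and \<open>\<beta> = 2 - 2 * \<alpha>\<close> the equation
\<open>(x powr (2 * \<alpha>) * \<phi>')' = \<phi>\<close> becomes the system for \<open>P\<close> and \<open>R\<close> stated here,
whose regular solution is entire (up to a change of variables, a modified Bessel function of the
first kind). Comparing coefficients in \<open>R = \<beta> * P'\<close> and \<open>R + \<beta> * t * R' = P\<close> yields the
recursion for the coefficients.\<close>

lemma power_series_solution:
  fixes \<beta> :: real
  assumes "0 < \<beta>"
  obtains P R R' :: "real \<Rightarrow> real" where
    "\<And>t. (P has_real_derivative R t / \<beta>) (at t)"
    "\<And>t. (R has_real_derivative R' t) (at t)"
    "\<And>t. R t + \<beta> * t * R' t = P t"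
    "\<And>t. 0 \<le> t \<Longrightarrow> 1 \<le> P t"
proof -
  define c where "c n = (\<Prod>k<n. 1 / (\<beta> * (real k + 1) * (\<beta> * real k + 1)))" for n
  have c0: "c 0 = 1" by (simp add: c_def)
  have cSuc: "c (Suc n) = c n / (\<beta> * (real n + 1) * (\<beta> * real n + 1))" for n
    by (simp add: c_def)
  have cpos: "0 < c n" for n
    unfolding c_def using assms by (intro prod_pos) (auto intro!: divide_pos_pos mult_pos_pos add_nonneg_pos)
  have bound: "c n \<le> (1 / \<beta>) ^ n / fact n" for n
  proof (induction n)
    case (Suc n)
    have "c (Suc n) \<le> c n / (\<beta> * (real n + 1) * 1)"
      unfolding cSuc using cpos[of n] assms
      by (intro divide_left_mono mult_left_mono mult_pos_pos) (auto intro: add_nonneg_pos)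
    also have "\<dots> \<le> ((1 / \<beta>) ^ n / fact n) / (\<beta> * (real n + 1) * 1)"
      using Suc assms by (intro divide_right_mono) auto
    also have "\<dots> = (1 / \<beta>) ^ Suc n / fact (Suc n)" by (simp add: field_simps)
    finally show ?case .
  qed (simp add: c0)
  have sumc: "summable (\<lambda>n. c n * t ^ n)" for t
  proof (rule summable_comparison_test')
    show "summable (\<lambda>n. (\<bar>t\<bar> / \<beta>) ^ n / fact n)"
      using summable_exp[of "\<bar>t\<bar> / \<beta>"] by (simp add: field_simps)
    show "norm (c n * t ^ n) \<le> (\<bar>t\<bar> / \<beta>) ^ n / fact n" if "0 \<le> n" for n
    proof -
      have "norm (c n * t ^ n) = c n * \<bar>t\<bar> ^ n"
        using cpos[of n] by (simp add: abs_mult power_abs)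
      also have "\<dots> \<le> (1 / \<beta>) ^ n / fact n * \<bar>t\<bar> ^ n" by (intro mult_right_mono bound) auto
      also have "\<dots> = (\<bar>t\<bar> / \<beta>) ^ n / fact n" by (simp add: power_divide)
      finally show ?thesis .
    qed
  qed
  define r where "r n = \<beta> * diffs c n" for n
  have r: "r n * (1 + \<beta> * real n) = c n" for n
  proof -
    have nz: "\<beta> * real n + 1 > 0" "\<beta> * (real n + 1) > 0" using assms by (auto intro: add_nonneg_pos)
    have cancel: "A * (c n / (A * D)) * D = c n" if "A > 0" "D > 0" for A D :: real
      using that by simp
    have "r n * (1 + \<beta> * real n) =
        (\<beta> * (real n + 1)) * (c n / ((\<beta> * (real n + 1)) * (\<beta> * real n + 1))) * (\<beta> * real n + 1)"
      by (simp add: r_def diffs_def cSuc add.commute mult.assoc)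
    also have "\<dots> = c n" by (rule cancel[OF nz(2,1)])
    finally show ?thesis .
  qed
  have sumr: "summable (\<lambda>n. r n * t ^ n)" for t
    unfolding r_def using termdiff_converges_all[OF sumc, of t]
    by (simp add: mult.assoc summable_mult)
  define P R R' where "P t = (\<Sum>n. c n * t ^ n)" and "R t = (\<Sum>n. r n * t ^ n)"
    and "R' t = (\<Sum>n. diffs r n * t ^ n)" for t :: real
  show ?thesis
  proof (rule that[of P R R'])
    fix t :: real
    have "R t = \<beta> * (\<Sum>n. diffs c n * t ^ n)"
      unfolding R_def r_def using termdiff_converges_all[OF sumc, of t]
      by (simp add: mult.assoc suminf_mult)
    then show "(P has_real_derivative R t / \<beta>) (at t)"
      using termdiffs_strong_converges_everywhere[OF sumc, of t] assms by (simp add: P_def[abs_def])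
    show "(R has_real_derivative R' t) (at t)"
      using termdiffs_strong_converges_everywhere[OF sumr, of t] by (simp add: R_def[abs_def] R'_def)
    have "(\<lambda>n. real n * r n * t ^ (n - Suc 0)) sums R' t"
      unfolding R'_def using diffs_equiv[OF termdiff_converges_all[OF sumr, of t]] by simp
    then have "(\<lambda>n. \<beta> * t * (real n * r n * t ^ (n - Suc 0))) sums (\<beta> * t * R' t)"
      by (rule sums_mult)
    moreover have "\<beta> * t * (real n * r n * t ^ (n - Suc 0)) = \<beta> * real n * r n * t ^ n" for n
      by (cases n) auto
    ultimately have "(\<lambda>n. \<beta> * real n * r n * t ^ n) sums (\<beta> * t * R' t)" by simp
    moreover have "(\<lambda>n. r n * t ^ n) sums R t" unfolding R_def by (rule summable_sums[OF sumr])
    ultimately have "(\<lambda>n. r n * t ^ n + \<beta> * real n * r n * t ^ n) sums (R t + \<beta> * t * R' t)"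
      by (rule sums_add[rotated])
    moreover have "r n * t ^ n + \<beta> * real n * r n * t ^ n = c n * t ^ n" for n
      by (simp add: r[symmetric] algebra_simps)
    ultimately have "(\<lambda>n. c n * t ^ n) sums (R t + \<beta> * t * R' t)" by simp
    then show "R t + \<beta> * t * R' t = P t" unfolding P_def by (rule sums_unique)
  next
    fix t :: real assume "0 \<le> t"
    have "(\<Sum>n<1. c n * t ^ n) \<le> P t"
      unfolding P_def using \<open>0 \<le> t\<close> cpos by (intro sum_le_suminf sumc) (auto intro!: mult_nonneg_nonneg less_imp_le[OF cpos])
    then show "1 \<le> P t" by (simp add: c0)
  qed
qed

lemma integral_lower_limit_has_derivative:
  fixes k :: "real \<Rightarrow> real"
  assumes k: "continuous_on {0<..1} k" and x: "x \<in> {0<..1}"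
  shows "((\<lambda>x. integral {x..1} k) has_real_derivative - k x) (at x within {0<..1})"
proof -
  define a where "a = x / 2"
  have a: "0 < a" "a < x" using x by (auto simp: a_def)
  have contk: "continuous_on {a..1} k" using a by (intro continuous_on_subset[OF k]) auto
  have "((\<lambda>y. integral {a..y} k) has_real_derivative k x) (at x within {a..1})"
    using a x by (intro integral_has_real_derivative contk) auto
  then have "((\<lambda>y. integral {a..1} k - integral {a..y} k) has_real_derivative - k x) (at x within {a..1})"
    by (auto intro!: derivative_eq_intros)
  moreover have "integral {a..1} k - integral {a..y} k = integral {y..1} k" if "y \<in> {a..1}" for y
    using Henstock_Kurzweil_Integration.integral_combine[of a y 1 k] that
      integrable_continuous_real[OF contk] by simp
  ultimately have "((\<lambda>y. integral {y..1} k) has_real_derivative - k x) (at x within {a..1})"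
    using a x by (elim has_field_derivative_transform_within[where d = 1]) auto
  moreover have "at x within {a..1} = at x within {0<..1}"
    by (rule at_within_nhd[where S = "{a<..}"]) (use a in auto)
  ultimately show ?thesis by simp
qed

text \<open>The solution \<open>\<phi>\<close> is regular at 0 with flux \<open>\<phi>1\<close>. Reduction of order gives the second
solution \<open>\<psi> = \<phi> * I\<close>, where \<open>I\<close> integrates \<open>s powr (- 2 * \<alpha>) / (\<phi> s)\<^sup>2\<close> from
\<open>x\<close> to 1; it satisfies the boundary condition at 1. As \<open>\<alpha> < 1\<close>, the possible growth of
\<open>\<psi>\<close> at 0 is weaker than \<open>1 / x\<close>: a power \<open>x powr (\<gamma> - 1)\<close> with a positive \<open>\<gamma>\<close>.
This gain makes the contribution of the data on \<open>{x..1}\<close> negligible near 0.\<close>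

lemma fundamental_system:
  fixes \<alpha> :: real
  assumes "\<alpha> < 1"
  obtains \<phi> \<phi>1 \<psi> \<psi>1 :: "real \<Rightarrow> real" and \<gamma> M :: real where
    "0 < \<gamma>" "\<gamma> < 1" "0 < M" "continuous_on {0..1} \<phi>" "\<psi> 1 = 0"
    "\<And>x. x \<in> {0<..1} \<Longrightarrow> (\<phi> has_real_derivative x powr (- 2 * \<alpha>) * \<phi>1 x) (at x within {0<..1})"
    "\<And>x. x \<in> {0<..1} \<Longrightarrow> (\<phi>1 has_real_derivative \<phi> x) (at x within {0<..1})"
    "\<And>x. x \<in> {0<..1} \<Longrightarrow> (\<psi> has_real_derivative x powr (- 2 * \<alpha>) * \<psi>1 x) (at x within {0<..1})"
    "\<And>x. x \<in> {0<..1} \<Longrightarrow> (\<psi>1 has_real_derivative \<psi> x) (at x within {0<..1})"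
    "\<And>x. x \<in> {0<..1} \<Longrightarrow> \<phi>1 x * \<psi> x - \<phi> x * \<psi>1 x = 1"
    "\<And>x. x \<in> {0..1} \<Longrightarrow> 0 \<le> \<phi> x \<and> \<phi> x \<le> M"
    "\<And>x. x \<in> {0<..1} \<Longrightarrow> \<bar>\<phi>1 x\<bar> \<le> M * x"
    "\<And>x. x \<in> {0<..1} \<Longrightarrow> 0 \<le> \<psi> x \<and> \<psi> x \<le> M * x powr (\<gamma> - 1)"
    "\<And>x. x \<in> {0<..1} \<Longrightarrow> \<bar>\<psi>1 x\<bar> \<le> M"
proof -
  define \<beta> where "\<beta> = 2 - 2 * \<alpha>"
  have "0 < \<beta>" using assms by (simp add: \<beta>_def)
  obtain P R R' where
    P: "\<And>t. (P has_real_derivative R t / \<beta>) (at t)" and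
    R: "\<And>t. (R has_real_derivative R' t) (at t)" and
    PR: "\<And>t. R t + \<beta> * t * R' t = P t" and
    P1: "\<And>t. 0 \<le> t \<Longrightarrow> 1 \<le> P t"
    using power_series_solution[OF \<open>0 < \<beta>\<close>] by metis
  have contP: "continuous_on A P" and contR: "continuous_on A R" for A
    using P R by (auto intro!: continuous_at_imp_continuous_on DERIV_isCont)
  have bdd: "\<exists>B. \<forall>t\<in>{0..1}. \<bar>F t\<bar> \<le> B" if "continuous_on {0..1} F" for F :: "real \<Rightarrow> real"
  proof -
    have "bounded (F ` {0..1})" by (intro compact_imp_bounded compact_continuous_image that) auto
    then show ?thesis unfolding bounded_iff by auto
  qed
  obtain BP where BP: "\<And>t. t \<in> {0..1} \<Longrightarrow> \<bar>P t\<bar> \<le> BP" using bdd[OF contP] by blast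
  obtain BR where BR: "\<And>t. t \<in> {0..1} \<Longrightarrow> \<bar>R t\<bar> \<le> BR" using bdd[OF contR] by blast
  have "1 \<le> BP" using BP[of 0] P1[of 0] by auto
  have "0 \<le> BR" using BR[of 0] by auto
  define \<phi> where "\<phi> x = P (x powr \<beta>)" for x
  define \<phi>1 where "\<phi>1 x = x * R (x powr \<beta>)" for x
  have t01: "x powr \<beta> \<in> {0..1}" if "x \<in> {0..1}" for x
    using that \<open>0 < \<beta>\<close> by (auto intro: powr_le1)
  have \<phi>_ge: "1 \<le> \<phi> x" and \<phi>_le: "\<phi> x \<le> BP" if "x \<in> {0..1}" for x
    using t01[OF that] P1[of "x powr \<beta>"] BP[of "x powr \<beta>"] by (auto simp: \<phi>_def)
  have \<phi>1_le: "\<bar>\<phi>1 x\<bar> \<le> BR * x" if "x \<in> {0..1}" for x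
    using that mult_left_mono[OF BR[OF t01[OF that]], of x] by (simp add: \<phi>1_def abs_mult mult.commute)
  have d\<phi>: "(\<phi> has_real_derivative x powr (- 2 * \<alpha>) * \<phi>1 x) (at x within {0<..1})" if x: "x \<in> {0<..1}" for x
  proof -
    have "(\<phi> has_real_derivative R (x powr \<beta>) / \<beta> * (\<beta> * x powr (\<beta> - 1))) (at x)"
      unfolding \<phi>_def using x by (intro DERIV_chain2[OF P]) (auto intro!: derivative_eq_intros)
    moreover have "R (x powr \<beta>) / \<beta> * (\<beta> * x powr (\<beta> - 1)) = x powr (- 2 * \<alpha>) * \<phi>1 x"
    proof -
      have "\<beta> - 1 = - 2 * \<alpha> + 1" by (simp add: \<beta>_def)
      then have "x powr (\<beta> - 1) = x powr (- 2 * \<alpha>) * x powr 1" by (simp only: powr_add)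
      then have eq: "x powr (\<beta> - 1) = x powr (- 2 * \<alpha>) * x" using x by simp
      have "R (x powr \<beta>) / \<beta> * (\<beta> * x powr (\<beta> - 1)) = R (x powr \<beta>) * x powr (\<beta> - 1)"
        using \<open>0 < \<beta>\<close> by simp
      then show ?thesis by (simp only: eq \<phi>1_def mult_ac)
    qed
    ultimately show ?thesis by (simp only: has_field_derivative_at_within)
  qed
  have d\<phi>1: "(\<phi>1 has_real_derivative \<phi> x) (at x within {0<..1})" if x: "x \<in> {0<..1}" for x
  proof -
    have chain: "((\<lambda>x. R (x powr \<beta>)) has_real_derivative R' (x powr \<beta>) * (\<beta> * x powr (\<beta> - 1))) (at x)"
      using x by (intro DERIV_chain2[OF R]) (auto intro!: derivative_eq_intros)
    have "(\<phi>1 has_real_derivative 1 * R (x powr \<beta>) + R' (x powr \<beta>) * (\<beta> * x powr (\<beta> - 1)) * x) (at x)"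
      unfolding \<phi>1_def by (intro DERIV_mult DERIV_ident chain)
    moreover have "x powr (\<beta> - 1) * x = x powr \<beta>"
      using x powr_add[of x "\<beta> - 1" 1] by simp
    then have eq: "R' (x powr \<beta>) * (\<beta> * x powr (\<beta> - 1)) * x = \<beta> * x powr \<beta> * R' (x powr \<beta>)"
      by (metis mult.assoc mult.commute)
    have "1 * R (x powr \<beta>) + R' (x powr \<beta>) * (\<beta> * x powr (\<beta> - 1)) * x = \<phi> x"
      unfolding eq using PR[of "x powr \<beta>"] by (simp add: \<phi>_def)
    ultimately show ?thesis by (simp only: has_field_derivative_at_within)
  qed
  have cont\<phi>: "continuous_on {0..1} \<phi>"
    unfolding \<phi>_def using \<open>0 < \<beta>\<close>
    by (intro continuous_on_compose2[OF contP[of UNIV]] continuous_on_powr' continuous_intros) auto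
  define k where "k s = s powr (- 2 * \<alpha>) / (\<phi> s)\<^sup>2" for s
  have contk: "continuous_on {0<..1} k"
    unfolding k_def
  proof (intro continuous_intros continuous_on_subset[OF cont\<phi>])
    show "\<forall>s\<in>{0<..1}. (\<phi> s)\<^sup>2 \<noteq> 0"
    proof
      fix s :: real assume "s \<in> {0<..1}"
      then have "1 \<le> \<phi> s" by (intro \<phi>_ge) auto
      then show "(\<phi> s)\<^sup>2 \<noteq> 0" by simp
    qed
  qed auto
  define I where "I x = integral {x..1} k" for x
  have dI: "(I has_real_derivative - k x) (at x within {0<..1})" if "x \<in> {0<..1}" for x
    unfolding I_def by (rule integral_lower_limit_has_derivative[OF contk that])
  \<comment> \<open>Any \<open>\<gamma> \<le> \<beta>\<close> in the open unit interval works: \<open>\<gamma> \<le> \<beta>\<close> gives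
    \<open>s powr (- 2 * \<alpha>) \<le> s powr (\<gamma> - 2)\<close>, and \<open>\<gamma> < 1\<close> keeps the integral a pure power;
    at most \<open>1 / 2\<close> makes the factor \<open>1 / (1 - \<gamma>)\<close> at most 2.\<close>
  define \<gamma> where "\<gamma> = min (1 / 2) \<beta>"
  have \<gamma>: "0 < \<gamma>" "\<gamma> \<le> 1 / 2" "\<gamma> \<le> \<beta>" using \<open>0 < \<beta>\<close> by (auto simp: \<gamma>_def)
  have I_bounds: "0 \<le> I x" "I x \<le> 2 * x powr (\<gamma> - 1)" if x: "x \<in> {0<..1}" for x
  proof -
    have int: "k integrable_on {x..1}"
      using x by (intro integrable_continuous_real continuous_on_subset[OF contk]) auto
    show "0 \<le> I x" unfolding I_def using x by (intro integral_nonneg int) (auto simp: k_def)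
    have "(\<lambda>s. s powr (\<gamma> - 2)) integrable_on {x..1}"
      using x by (intro integrable_continuous_real continuous_intros) auto
    moreover have "k s \<le> s powr (\<gamma> - 2)" if s: "s \<in> {x..1}" for s
    proof -
      have "1 \<le> (\<phi> s)\<^sup>2" using \<phi>_ge[of s] s x by (simp add: one_le_power)
      then have "k s \<le> s powr (- 2 * \<alpha>) / 1" unfolding k_def by (intro divide_left_mono) auto
      also have "\<dots> \<le> s powr (\<gamma> - 2)" using s x \<gamma> by (simp add: \<beta>_def powr_mono')
      finally show ?thesis .
    qed
    ultimately have "I x \<le> integral {x..1} (\<lambda>s. s powr (\<gamma> - 2))"
      unfolding I_def by (intro integral_le int)
    also have "((\<lambda>s. s powr (\<gamma> - 2)) has_integral (1 powr (\<gamma> - 1) / (\<gamma> - 1) - x powr (\<gamma> - 1) / (\<gamma> - 1))) {x..1}"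
    proof (rule fundamental_theorem_of_calculus)
      fix s assume s: "s \<in> {x..1}"
      have "((\<lambda>s. s powr (\<gamma> - 1) / (\<gamma> - 1)) has_real_derivative s powr (\<gamma> - 2)) (at s within {x..1})"
        using s x \<gamma> by (auto intro!: derivative_eq_intros)
      then show "((\<lambda>s. s powr (\<gamma> - 1) / (\<gamma> - 1)) has_vector_derivative s powr (\<gamma> - 2)) (at s within {x..1})"
        by (simp add: has_real_derivative_iff_has_vector_derivative)
    qed (use x in simp)
    then have "integral {x..1} (\<lambda>s. s powr (\<gamma> - 2)) = (x powr (\<gamma> - 1) - 1) / (1 - \<gamma>)"
      using \<gamma> by (simp add: integral_unique field_simps)
    also have "\<dots> \<le> x powr (\<gamma> - 1) / (1 / 2)"
      using \<gamma> by (intro frac_le) auto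
    finally show "I x \<le> 2 * x powr (\<gamma> - 1)" by simp
  qed
  define \<psi> where "\<psi> x = \<phi> x * I x" for x
  define \<psi>1 where "\<psi>1 x = \<phi>1 x * I x - 1 / \<phi> x" for x
  define M where "M = 2 * BP + 2 * BR + 1"
  show ?thesis
  proof (rule that[of \<gamma> M \<phi> \<psi> \<phi>1 \<psi>1])
    show "0 < \<gamma>" "\<gamma> < 1" using \<gamma> by auto
    show "0 < M" using \<open>1 \<le> BP\<close> \<open>0 \<le> BR\<close> by (simp add: M_def)
    show "continuous_on {0..1} \<phi>" by fact
    show "\<psi> 1 = 0" by (simp add: \<psi>_def I_def)
    fix x :: real
    { assume x: "x \<in> {0..1}"
      show "0 \<le> \<phi> x \<and> \<phi> x \<le> M"
        using \<phi>_ge[OF x] \<phi>_le[OF x] \<open>1 \<le> BP\<close> \<open>0 \<le> BR\<close> by (simp add: M_def) }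
    assume x: "x \<in> {0<..1}"
    then have x': "x \<in> {0..1}" by auto
    have \<phi>x: "1 \<le> \<phi> x" "\<phi> x \<noteq> 0" using \<phi>_ge[OF x'] by auto
    show "(\<phi> has_real_derivative x powr (- 2 * \<alpha>) * \<phi>1 x) (at x within {0<..1})" by (rule d\<phi>[OF x])
    show "(\<phi>1 has_real_derivative \<phi> x) (at x within {0<..1})" by (rule d\<phi>1[OF x])
    show "(\<psi> has_real_derivative x powr (- 2 * \<alpha>) * \<psi>1 x) (at x within {0<..1})"
      unfolding \<psi>_def
      by (rule derivative_eq_intros d\<phi>[OF x] dI[OF x])+
        (use \<phi>x in \<open>simp add: \<psi>1_def k_def field_simps power2_eq_square\<close>)
    show "(\<psi>1 has_real_derivative \<psi> x) (at x within {0<..1})"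
    proof -
      have inv: "((\<lambda>y. 1 / \<phi> y) has_real_derivative - (x powr (- 2 * \<alpha>) * \<phi>1 x) / (\<phi> x)\<^sup>2) (at x within {0<..1})"
        using DERIV_divide[OF DERIV_const d\<phi>[OF x] \<phi>x(2), of 1] by (simp add: power2_eq_square)
      have "(\<psi>1 has_real_derivative (\<phi>1 x * (- k x) + \<phi> x * I x) - - (x powr (- 2 * \<alpha>) * \<phi>1 x) / (\<phi> x)\<^sup>2) (at x within {0<..1})"
        unfolding \<psi>1_def
        by (intro DERIV_diff inv DERIV_mult'[OF d\<phi>1[OF x] dI[OF x]])
      then show ?thesis by (simp add: k_def \<psi>_def)
    qed
    show "\<phi>1 x * \<psi> x - \<phi> x * \<psi>1 x = 1"
      using \<phi>x by (simp add: \<psi>_def \<psi>1_def field_simps)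
    show "\<bar>\<phi>1 x\<bar> \<le> M * x"
    proof -
      have "BR * x \<le> M * x" using x \<open>1 \<le> BP\<close> \<open>0 \<le> BR\<close> by (intro mult_right_mono) (auto simp: M_def)
      then show ?thesis using \<phi>1_le[OF x'] by simp
    qed
    show "0 \<le> \<psi> x \<and> \<psi> x \<le> M * x powr (\<gamma> - 1)"
    proof
      show "0 \<le> \<psi> x" using \<phi>x I_bounds[OF x] by (simp add: \<psi>_def)
      have "\<psi> x \<le> BP * (2 * x powr (\<gamma> - 1))"
        unfolding \<psi>_def using \<phi>x \<phi>_le[OF x'] I_bounds[OF x] \<open>1 \<le> BP\<close> by (intro mult_mono) auto
      also have "\<dots> \<le> M * x powr (\<gamma> - 1)"
        using \<open>0 \<le> BR\<close> by (simp add: M_def algebra_simps)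
      finally show "\<psi> x \<le> M * x powr (\<gamma> - 1)" .
    qed
    show "\<bar>\<psi>1 x\<bar> \<le> M"
    proof -
      have "\<bar>\<phi>1 x * I x\<bar> \<le> (BR * x) * (2 * x powr (\<gamma> - 1))"
        unfolding abs_mult using \<phi>1_le[OF x'] I_bounds[OF x] x \<open>0 \<le> BR\<close> by (intro mult_mono) auto
      also have "\<dots> = 2 * BR * x powr \<gamma>"
        using x powr_add[of x "\<gamma> - 1" 1] by simp
      also have "\<dots> \<le> 2 * BR * 1"
        using x \<gamma> \<open>0 \<le> BR\<close> by (intro mult_left_mono powr_le1) auto
      finally have "\<bar>\<phi>1 x * I x\<bar> \<le> 2 * BR" by simp
      moreover have "\<bar>1 / \<phi> x\<bar> \<le> 1" using \<phi>x by simp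
      ultimately show ?thesis unfolding \<psi>1_def M_def using \<open>1 \<le> BP\<close> by linarith
    qed
  qed
qed

section \<open>Existence and the upper bound\<close>

lemma primitive_on_integral_from_0:
  assumes "g absolutely_integrable_on {0..1}"
  shows "primitive_on {0<..1} (\<lambda>x. integral {0..x} g) g"
  unfolding primitive_on_def
proof (intro ballI impI conjI)
  fix c d :: real assume cd: "c \<in> {0<..1}" "d \<in> {0<..1}" "c \<le> d"
  show "g absolutely_integrable_on {c..d}"
    using cd by (intro absolutely_integrable_on_subinterval[OF assms]) auto
  have "g integrable_on {0..d}"
    using cd by (intro set_lebesgue_integral_eq_integral(1) absolutely_integrable_on_subinterval[OF assms]) auto
  then show "integral {0..d} g - integral {0..c} g = integral {c..d} g"
    using Henstock_Kurzweil_Integration.integral_combine[of 0 c d g] cd by simp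
qed

lemma primitive_on_integral_to_1:
  assumes "\<And>c. 0 < c \<Longrightarrow> g absolutely_integrable_on {c..1}"
  shows "primitive_on {0<..1} (\<lambda>x. integral {x..1} g) (\<lambda>x. - g x)"
  unfolding primitive_on_def
proof (intro ballI impI conjI)
  fix c d :: real assume cd: "c \<in> {0<..1}" "d \<in> {0<..1}" "c \<le> d"
  have "g absolutely_integrable_on {c..1}" using cd by (intro assms) auto
  then have "g absolutely_integrable_on {c..d}" and int: "g integrable_on {c..1}"
    using cd by (auto intro: set_lebesgue_integral_eq_integral(1) absolutely_integrable_on_subinterval)
  then show "(\<lambda>x. - g x) absolutely_integrable_on {c..d}"
    by (simp add: absolutely_integrable_on_def integrable_neg)
  show "integral {d..1} g - integral {c..1} g = integral {c..d} (\<lambda>x. - g x)"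
    using Henstock_Kurzweil_Integration.integral_combine[of c d 1 g] cd int by simp
qed

lemma primitive_on_half_open_continuous:
  assumes "primitive_on {0<..1} u g"
  shows "continuous_on {0<..1} u"
  unfolding continuous_on_eq_continuous_within
proof
  fix x :: real assume x: "x \<in> {0<..1}"
  have "continuous_on {x / 2..1} u"
    using x by (intro primitive_on_continuous[OF assms]) auto
  then have "continuous (at x within {x / 2..1}) u"
    using x by (auto simp: continuous_on_eq_continuous_within)
  moreover have "at x within {x / 2..1} = at x within {0<..1}"
    by (rule at_within_nhd[where S = "{x / 2<..}"]) (use x in auto)
  ultimately show "continuous (at x within {0<..1}) u" by simp
qed

text \<open>Variation of constants, with the Wronskian normalised to 1, gives
\<open>u = \<psi> * A + \<phi> * B\<close> and the flux \<open>z = \<psi>1 * A + \<phi>1 * B\<close>, where \<open>A\<close> integrates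
\<open>\<phi> * f\<close> over \<open>{0..x}\<close> and \<open>B\<close> integrates \<open>\<psi> * f\<close> over \<open>{x..1}\<close>. The weighted
inequality bounds \<open>A\<close> by a multiple of \<open>x powr (1 - r)\<close>; for \<open>B\<close>, the factor
\<open>\<phi>1 x\<close>, of order \<open>x\<close>, compensates the growth of \<open>\<psi>\<close>.\<close>

lemma neumann_solution_exists_bounded:
  assumes "\<alpha> < 1" and p: "1 \<le> p"
  defines "r \<equiv> real_of_ereal (1 / p)"
  obtains K where "0 < K"
    "\<And>f. f \<in> Lp_space p {0<..<1} \<Longrightarrow> Lp_norm p {0<..<1} f \<le> 1 \<Longrightarrow>
      \<exists>u. neumann_solution \<alpha> p f u \<and>
        (\<forall>x\<in>{0<..<1}. \<bar>deriv u x\<bar> \<le> K * x powr (- 2 * \<alpha>) * x powr (1 - r))"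
proof -
  obtain \<phi> \<phi>1 \<psi> \<psi>1 \<gamma> M where
    \<gamma>: "0 < \<gamma>" "\<gamma> < 1" and M: "0 < M" and cont\<phi>: "continuous_on {0..1} \<phi>" and \<psi>_1: "\<psi> 1 = 0"
    and d\<phi>: "\<And>x. x \<in> {0<..1} \<Longrightarrow> (\<phi> has_real_derivative x powr (- 2 * \<alpha>) * \<phi>1 x) (at x within {0<..1})"
    and d\<phi>1: "\<And>x. x \<in> {0<..1} \<Longrightarrow> (\<phi>1 has_real_derivative \<phi> x) (at x within {0<..1})"
    and d\<psi>: "\<And>x. x \<in> {0<..1} \<Longrightarrow> (\<psi> has_real_derivative x powr (- 2 * \<alpha>) * \<psi>1 x) (at x within {0<..1})"
    and d\<psi>1: "\<And>x. x \<in> {0<..1} \<Longrightarrow> (\<psi>1 has_real_derivative \<psi> x) (at x within {0<..1})"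
    and wronskian: "\<And>x. x \<in> {0<..1} \<Longrightarrow> \<phi>1 x * \<psi> x - \<phi> x * \<psi>1 x = 1"
    and b\<phi>: "\<And>x. x \<in> {0..1} \<Longrightarrow> 0 \<le> \<phi> x \<and> \<phi> x \<le> M"
    and b\<phi>1: "\<And>x. x \<in> {0<..1} \<Longrightarrow> \<bar>\<phi>1 x\<bar> \<le> M * x"
    and b\<psi>: "\<And>x. x \<in> {0<..1} \<Longrightarrow> 0 \<le> \<psi> x \<and> \<psi> x \<le> M * x powr (\<gamma> - 1)"
    and b\<psi>1: "\<And>x. x \<in> {0<..1} \<Longrightarrow> \<bar>\<psi>1 x\<bar> \<le> M"
    by (rule fundamental_system[OF \<open>\<alpha> < 1\<close>]) (rule that; assumption)
  have cont: "continuous_on {0<..1} \<phi>" "continuous_on {0<..1} \<phi>1" "continuous_on {0<..1} \<psi>" "continuous_on {0<..1} \<psi>1"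
    by (rule DERIV_continuous_on, erule d\<phi> d\<phi>1 d\<psi> d\<psi>1)+
  have prim: "primitive_on {0<..1} \<phi> (\<lambda>x. x powr (- 2 * \<alpha>) * \<phi>1 x)" "primitive_on {0<..1} \<phi>1 \<phi>"
    "primitive_on {0<..1} \<psi> (\<lambda>x. x powr (- 2 * \<alpha>) * \<psi>1 x)" "primitive_on {0<..1} \<psi>1 \<psi>"
    by (intro primitive_on_if_has_derivative d\<phi> d\<phi>1 d\<psi> d\<psi>1 is_interval_oc continuous_intros cont; force)+
  define K where "K = 2 * M\<^sup>2 + M\<^sup>2 / \<gamma> + M\<^sup>2"
  have "0 < K" using M \<gamma> by (auto simp: K_def intro!: add_pos_pos add_pos_nonneg)
  moreover have "\<exists>u. neumann_solution \<alpha> p f u \<and>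
        (\<forall>x\<in>{0<..<1}. \<bar>deriv u x\<bar> \<le> K * x powr (- 2 * \<alpha>) * x powr (1 - r))"
    if f: "f \<in> Lp_space p {0<..<1}" and norm: "Lp_norm p {0<..<1} f \<le> 1" for f
  proof -
    have fi: "f absolutely_integrable_on {0..1}" by (rule Lp_space_imp_absolutely_integrable[OF f p])
    then have afi: "(\<lambda>s. \<bar>f s\<bar>) absolutely_integrable_on {0..1}"
      using absolutely_integrable_norm[OF fi] by (simp add: o_def)
    have fi': "f absolutely_integrable_on {c..d}" "(\<lambda>s. \<bar>f s\<bar>) absolutely_integrable_on {c..d}" if "0 \<le> c" "d \<le> 1" for c d
      using that by (auto intro!: absolutely_integrable_on_subinterval[OF fi] absolutely_integrable_on_subinterval[OF afi])
    have \<phi>f: "(\<lambda>s. \<phi> s * f s) absolutely_integrable_on {c..d}" "(\<lambda>s. \<phi> s * \<bar>f s\<bar>) absolutely_integrable_on {c..d}"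
      if "0 \<le> c" "d \<le> 1" for c d
      using that by (auto intro!: absolutely_integrable_continuous_mult fi' continuous_on_subset[OF cont\<phi>])
    have \<psi>f: "(\<lambda>s. \<psi> s * f s) absolutely_integrable_on {c..d}" "(\<lambda>s. \<psi> s * \<bar>f s\<bar>) absolutely_integrable_on {c..d}"
      if "0 < c" "d \<le> 1" for c d
      using that by (auto intro!: absolutely_integrable_continuous_mult fi' continuous_on_subset[OF cont(3)])
    define A where "A x = integral {0..x} (\<lambda>s. \<phi> s * f s)" for x
    define B where "B x = integral {x..1} (\<lambda>s. \<psi> s * f s)" for x
    have primA: "primitive_on {0<..1} A (\<lambda>s. \<phi> s * f s)"
      unfolding A_def by (intro primitive_on_integral_from_0 \<phi>f) auto
    have primB: "primitive_on {0<..1} B (\<lambda>s. - (\<psi> s * f s))"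
      unfolding B_def by (intro primitive_on_integral_to_1 \<psi>f) auto
    define u where "u x = \<psi> x * A x + \<phi> x * B x" for x
    define z where "z x = \<psi>1 x * A x + \<phi>1 x * B x" for x
    have uz: "primitive_on {0<..1} u (\<lambda>x. x powr (- 2 * \<alpha>) * z x)"
      by (rule primitive_on_cong[OF primitive_on_add[OF
            primitive_on_mult[OF prim(3) primA is_interval_oc] primitive_on_mult[OF prim(1) primB is_interval_oc]]])
        (auto simp: u_def z_def is_interval_oc algebra_simps)
    have zu: "primitive_on {0<..1} z (\<lambda>x. u x - f x)"
    proof (rule primitive_on_cong[OF primitive_on_add[OF
            primitive_on_mult[OF prim(4) primA is_interval_oc] primitive_on_mult[OF prim(2) primB is_interval_oc]]])
      fix x :: real assume "x \<in> {0<..1}"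
      have "(\<psi>1 x * (\<phi> x * f x) + A x * \<psi> x) + (\<phi>1 x * (- (\<psi> x * f x)) + B x * \<phi> x)
          = u x - (\<phi>1 x * \<psi> x - \<phi> x * \<psi>1 x) * f x"
        by (simp add: u_def algebra_simps)
      then show "(\<psi>1 x * (\<phi> x * f x) + A x * \<psi> x) + (\<phi>1 x * (- (\<psi> x * f x)) + B x * \<phi> x) = u x - f x"
        using wronskian[OF \<open>x \<in> {0<..1}\<close>] by simp
    qed (auto simp: z_def is_interval_oc)
    have absA: "\<bar>A x\<bar> \<le> integral {0..x} (\<lambda>s. \<phi> s * \<bar>f s\<bar>)" if "x \<in> {0<..1}" for x
      unfolding A_def real_norm_def[symmetric]
    proof (rule integral_norm_bound_integral)
      show "(\<lambda>s. \<phi> s * f s) integrable_on {0..x}" "(\<lambda>s. \<phi> s * norm (f s)) integrable_on {0..x}"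
        using that \<phi>f[of 0 x] by (auto intro: set_lebesgue_integral_eq_integral(1))
      show "norm (\<phi> s * f s) \<le> \<phi> s * norm (f s)" if "s \<in> {0..x}" for s
        using that \<open>x \<in> {0<..1}\<close> b\<phi>[of s] by (simp add: abs_mult)
    qed
    have absB: "\<bar>B x\<bar> \<le> integral {x..1} (\<lambda>s. M * s powr (\<gamma> - 1) * \<bar>f s\<bar>)" if "x \<in> {0<..1}" for x
      unfolding B_def real_norm_def[symmetric]
    proof (rule integral_norm_bound_integral)
      show "(\<lambda>s. \<psi> s * f s) integrable_on {x..1}"
        using that \<psi>f[of x 1] by (auto intro: set_lebesgue_integral_eq_integral(1))
      show "(\<lambda>s. M * s powr (\<gamma> - 1) * norm (f s)) integrable_on {x..1}"
        using that by (auto intro!: set_lebesgue_integral_eq_integral(1) absolutely_integrable_continuous_mult fi' continuous_intros)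
      show "norm (\<psi> s * f s) \<le> M * s powr (\<gamma> - 1) * norm (f s)" if "s \<in> {x..1}" for s
        using that \<open>x \<in> {0<..1}\<close> b\<psi>[of s] by (auto simp: abs_mult intro!: mult_right_mono)
    qed
    have lim: "(z \<longlongrightarrow> 0) (at_right 0)"
    proof -
      have "continuous_on {0..1} A"
        unfolding A_def using \<phi>f[of 0 1]
        by (intro indefinite_integral_continuous_1) (auto intro: set_lebesgue_integral_eq_integral(1))
      then have "(A \<longlongrightarrow> A 0) (at 0 within {0..1})" by (auto simp: continuous_on_def)
      moreover have "at 0 within {0..1} = at_right (0::real)"
        using at_within_Icc_at_right[of 0 "1::real"] by simp
      ultimately have limA: "(A \<longlongrightarrow> 0) (at_right 0)" by (simp add: A_def)
      define L where "L = integral {0..1} (\<lambda>s. \<bar>f s\<bar>)"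
      have "((\<lambda>x::real. x powr \<gamma>) \<longlongrightarrow> 0 powr \<gamma>) (at_right 0)"
        using \<gamma> by (intro tendsto_powr') (auto intro: tendsto_intros eventually_at_right_less simp: eventually_at_filter)
      then have limx: "((\<lambda>x::real. x powr \<gamma>) \<longlongrightarrow> 0) (at_right 0)" by simp
      have "((\<lambda>x. M * \<bar>A x\<bar> + M * M * L * x powr \<gamma>) \<longlongrightarrow> M * \<bar>0\<bar> + M * M * L * 0) (at_right 0)"
        by (intro tendsto_intros limA limx)
      then have "((\<lambda>x. M * \<bar>A x\<bar> + M * M * L * x powr \<gamma>) \<longlongrightarrow> 0) (at_right 0)" by simp
      moreover have "eventually (\<lambda>x. norm (z x) \<le> M * \<bar>A x\<bar> + M * M * L * x powr \<gamma>) (at_right 0)"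
      proof -
        have "eventually (\<lambda>x. x \<in> {0<..<1::real}) (at_right 0)" by (intro eventually_at_right_real) simp
        then show ?thesis
        proof eventually_elim
          case (elim x)
          then have x: "x \<in> {0<..1}" by auto
          have "integral {x..1} (\<lambda>s. M * s powr (\<gamma> - 1) * \<bar>f s\<bar>) \<le> integral {x..1} (\<lambda>s. M * x powr (\<gamma> - 1) * \<bar>f s\<bar>)"
          proof (rule integral_le)
            show "(\<lambda>s. M * s powr (\<gamma> - 1) * \<bar>f s\<bar>) integrable_on {x..1}"
              "(\<lambda>s. M * x powr (\<gamma> - 1) * \<bar>f s\<bar>) integrable_on {x..1}"
              using x by (auto intro!: set_lebesgue_integral_eq_integral(1) absolutely_integrable_continuous_mult fi' continuous_intros)
            show "M * s powr (\<gamma> - 1) * \<bar>f s\<bar> \<le> M * x powr (\<gamma> - 1) * \<bar>f s\<bar>" if "s \<in> {x..1}" for s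
              using that x M \<gamma> by (intro mult_right_mono mult_left_mono powr_mono2') auto
          qed
          also have "\<dots> = M * x powr (\<gamma> - 1) * integral {x..1} (\<lambda>s. \<bar>f s\<bar>)" by simp
          also have "\<dots> \<le> M * x powr (\<gamma> - 1) * L"
            unfolding L_def using x M fi'[of x 1] fi'[of 0 1]
            by (intro mult_left_mono integral_subset_le) (auto intro: set_lebesgue_integral_eq_integral(1))
          finally have "\<bar>B x\<bar> \<le> M * x powr (\<gamma> - 1) * L" using absB[OF x] by linarith
          then have "\<bar>\<phi>1 x\<bar> * \<bar>B x\<bar> \<le> (M * x) * (M * x powr (\<gamma> - 1) * L)"
            using b\<phi>1[OF x] M x by (intro mult_mono) auto
          also have "\<dots> = M * M * L * x powr \<gamma>"
            using x powr_add[of x "\<gamma> - 1" 1] by simp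
          finally have 1: "\<bar>\<phi>1 x * B x\<bar> \<le> M * M * L * x powr \<gamma>" by (simp add: abs_mult)
          have 2: "\<bar>\<psi>1 x * A x\<bar> \<le> M * \<bar>A x\<bar>" unfolding abs_mult using b\<psi>1[OF x] by (intro mult_right_mono) auto
          show ?case using 1 2 unfolding z_def by simp
        qed
      qed
      ultimately show ?thesis by (rule Lim_null_comparison[rotated])
    qed
    have bound: "\<bar>z x\<bar> \<le> K * x powr (1 - r)" if x: "x \<in> {0<..1}" for x
    proof -
      note weighted = weighted_integral_le_of_Lp_norm_le_1[OF f norm p, folded r_def, of x]
      have xr: "x powr (- r) * x = x powr (1 - r)"
        using x powr_add[of x "- r" 1] by (simp add: add.commute)
      have "\<bar>A x\<bar> \<le> x powr (- r) * integral {0..x} \<phi> + x powr (1 - r) * M"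
        using absA[OF x] weighted[of 0 x \<phi> M] x b\<phi> by (force intro: continuous_on_subset[OF cont\<phi>])
      moreover have "x powr (- r) * integral {0..x} \<phi> \<le> x powr (- r) * (M * x)"
      proof (rule mult_left_mono)
        have "integral {0..x} \<phi> \<le> integral {0..x} (\<lambda>_. M)"
          using x b\<phi> by (intro integral_le integrable_continuous_real continuous_on_subset[OF cont\<phi>]) auto
        then show "integral {0..x} \<phi> \<le> M * x" using x by (simp add: mult.commute)
      qed simp
      moreover have "x powr (- r) * (M * x) = M * x powr (1 - r)" by (simp add: mult.left_commute flip: xr)
      ultimately have "\<bar>A x\<bar> \<le> M * x powr (1 - r) + x powr (1 - r) * M" by linarith
      then have A_le: "\<bar>A x\<bar> \<le> 2 * M * x powr (1 - r)" by (simp add: algebra_simps)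
      have "\<bar>B x\<bar> \<le> x powr (- r) * integral {x..1} (\<lambda>s. M * s powr (\<gamma> - 1)) + x powr (1 - r) * (M * x powr (\<gamma> - 1))"
      proof -
        have "M * s powr (\<gamma> - 1) \<le> M * x powr (\<gamma> - 1)" if "s \<in> {x..1}" for s
          using that x M \<gamma> by (intro mult_left_mono powr_mono2') auto
        then show ?thesis
          using absB[OF x] x M
          by (intro order_trans[OF absB[OF x]] weighted) (auto intro!: continuous_intros)
      qed
      moreover have "integral {x..1} (\<lambda>s. M * s powr (\<gamma> - 1)) \<le> M / \<gamma>"
      proof -
        have "((\<lambda>s. M * s powr (\<gamma> - 1)) has_integral (M * 1 powr \<gamma> / \<gamma> - M * x powr \<gamma> / \<gamma>)) {x..1}"
        proof (rule fundamental_theorem_of_calculus)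
          fix s assume s: "s \<in> {x..1}"
          have "((\<lambda>s. M * s powr \<gamma> / \<gamma>) has_real_derivative M * s powr (\<gamma> - 1)) (at s within {x..1})"
            using s x \<gamma> by (auto intro!: derivative_eq_intros)
          then show "((\<lambda>s. M * s powr \<gamma> / \<gamma>) has_vector_derivative M * s powr (\<gamma> - 1)) (at s within {x..1})"
            by (simp add: has_real_derivative_iff_has_vector_derivative)
        qed (use x in simp)
        moreover have "0 \<le> M * x powr \<gamma> / \<gamma>" using M \<gamma> by simp
        ultimately show ?thesis by (simp add: integral_unique del: integral_mult_right)
      qed
      then have "x powr (- r) * integral {x..1} (\<lambda>s. M * s powr (\<gamma> - 1)) \<le> x powr (- r) * (M / \<gamma>)"
        by (intro mult_left_mono) auto
      ultimately have B_le: "\<bar>B x\<bar> \<le> x powr (- r) * (M / \<gamma>) + x powr (1 - r) * (M * x powr (\<gamma> - 1))"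
        by linarith
      have "\<bar>\<psi>1 x * A x\<bar> \<le> M * (2 * M * x powr (1 - r))"
        unfolding abs_mult using b\<psi>1[OF x] A_le M by (intro mult_mono) auto
      moreover have "\<bar>\<phi>1 x * B x\<bar> \<le> M\<^sup>2 / \<gamma> * x powr (1 - r) + M\<^sup>2 * x powr (1 - r)"
      proof -
        have "\<bar>\<phi>1 x * B x\<bar> \<le> (M * x) * (x powr (- r) * (M / \<gamma>) + x powr (1 - r) * (M * x powr (\<gamma> - 1)))"
          unfolding abs_mult using b\<phi>1[OF x] B_le M x by (intro mult_mono) auto
        also have "\<dots> = M\<^sup>2 / \<gamma> * (x powr (- r) * x) + M\<^sup>2 * x powr (1 - r) * (x powr (\<gamma> - 1) * x)"
          by (simp add: algebra_simps power2_eq_square)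
        also have "\<dots> \<le> M\<^sup>2 / \<gamma> * (x powr (- r) * x) + M\<^sup>2 * x powr (1 - r) * 1"
        proof -
          have "x powr (\<gamma> - 1) * x = x powr \<gamma>"
            using x powr_add[of x "\<gamma> - 1" 1] by simp
          moreover have "x powr \<gamma> \<le> 1" using x \<gamma> by (intro powr_le1) auto
          ultimately have "x powr (\<gamma> - 1) * x \<le> 1" by simp
          then show ?thesis by (intro add_left_mono mult_left_mono) auto
        qed
        finally show ?thesis by (simp only: xr mult_1_right)
      qed
      moreover have "M * (2 * M * x powr (1 - r)) + (M\<^sup>2 / \<gamma> * x powr (1 - r) + M\<^sup>2 * x powr (1 - r)) = K * x powr (1 - r)"
        by (simp add: K_def algebra_simps power2_eq_square)
      ultimately have "\<bar>\<psi>1 x * A x\<bar> + \<bar>\<phi>1 x * B x\<bar> \<le> K * x powr (1 - r)"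
        by linarith
      then show ?thesis unfolding z_def by linarith
    qed
    have contu: "continuous_on {0<..1} u" and contz: "continuous_on {0<..1} z"
      by (rule primitive_on_half_open_continuous[OF uz], rule primitive_on_half_open_continuous[OF zu])
    have "u 1 = 0" by (simp add: u_def \<psi>_1 B_def)
    note sol = neumann_solutionI[OF f p contu contz uz zu \<open>u 1 = 0\<close> lim]
    show ?thesis
    proof (intro exI[of _ "restrict u {0<..1}"] conjI ballI sol(1))
      fix x :: real assume x: "x \<in> {0<..<1}"
      have "\<bar>deriv (restrict u {0<..1}) x\<bar> = x powr (- 2 * \<alpha>) * \<bar>z x\<bar>"
        unfolding sol(2)[OF x] by (simp add: abs_mult)
      also have "\<dots> \<le> x powr (- 2 * \<alpha>) * (K * x powr (1 - r))"
        using x by (intro mult_left_mono bound) auto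
      finally show "\<bar>deriv (restrict u {0<..1}) x\<bar> \<le> K * x powr (- 2 * \<alpha>) * x powr (1 - r)"
        by (simp only: mult_ac)
    qed
  qed
  ultimately show ?thesis by (rule that)
qed

section \<open>The lower bound and the theorem\<close>

text \<open>The height \<open>x powr (- 1 / p)\<close> on an interval of length \<open>2 * x\<close> is the scaling that leaves
the norm bounded independently of \<open>x\<close>.\<close>

lemma Lp_unit_ball_if_concentrated:
  assumes p: "1 \<le> p" and x: "0 < x" "x \<le> 1 / 2"
    and f: "f \<in> borel_measurable (lebesgue_on {0<..<1})"
    and bound: "\<And>s. s \<in> {0<..<2 * x} \<Longrightarrow> \<bar>f s\<bar> \<le> x powr (- real_of_ereal (1 / p)) / 2"
    and zero: "\<And>s. s \<in> {2 * x..<1} \<Longrightarrow> f s = 0"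
  shows "f \<in> Lp_space p {0<..<1} \<and> Lp_norm p {0<..<1} f \<le> 1"
proof (cases "p = \<infinity>")
  case True
  let ?E = "esssup (lebesgue_on {0<..<1}) (\<lambda>x. ereal \<bar>f x\<bar>)"
  have "\<bar>f s\<bar> \<le> 1 / 2" if "s \<in> {0<..<1}" for s
    using that bound[of s] zero[of s] x True by (cases "s < 2 * x") auto
  then have "?E \<le> ereal (1 / 2)" using f by (intro esssup_I AE_I2) auto
  then have "?E < \<infinity>" "real_of_ereal ?E \<le> 1" by (cases ?E; auto)+
  then show ?thesis using f True by (simp add: Lp_space_def Lp_norm_def)
next
  case False
  define q where "q = real_of_ereal p"
  have q: "1 \<le> q" "p = ereal q" using p False by (cases p; auto simp: q_def)+
  have r: "real_of_ereal (1 / p) = 1 / q" using q by (simp add: one_ereal_def)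
  let ?M = "lebesgue_on {0<..<1::real}"
  define h where "h s = (1 / 2) powr q / x * indicator {0<..<2 * x} s" for s :: real
  have sub: "{0<..<2 * x} \<subseteq> {0<..<1}" using x by auto
  have meas: "measure ?M {0<..<2 * x} = 2 * x"
    using x sub by (simp add: measure_restrict_space)
  have "emeasure ?M {0<..<2 * x} < \<infinity>"
    using x sub by (simp add: emeasure_restrict_space)
  then have indi: "integrable ?M (indicator {0<..<2 * x} :: real \<Rightarrow> real)"
    using sub by (intro integrable_real_indicator) (auto simp: sets_restrict_space_iff)
  then have h: "integrable ?M h" unfolding h_def by (intro integrable_mult_right)
  have fh: "\<bar>f s\<bar> powr q \<le> h s" if "s \<in> {0<..<1}" for s
  proof (cases "s < 2 * x")
    case True
    then have "\<bar>f s\<bar> powr q \<le> (x powr (- (1 / q)) / 2) powr q"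
      using bound[of s, unfolded r] that q(1) by (intro powr_mono2) auto
    also have "\<dots> = (1 / 2) powr q / x"
    proof -
      have "(x powr (- (1 / q))) powr q = 1 / x"
        unfolding powr_powr using q x by (simp add: powr_minus_divide)
      then show ?thesis using x by (simp add: powr_divide powr_one_eq_one)
    qed
    finally show ?thesis using True that by (simp add: h_def)
  next
    case False
    then show ?thesis using zero[of s] that x by (simp add: h_def)
  qed
  have fi: "integrable ?M (\<lambda>s. \<bar>f s\<bar> powr q)"
    using h by (rule Bochner_Integration.integrable_bound) (use f fh in \<open>auto intro!: AE_I2 simp: order_trans[OF _ abs_ge_self]\<close>)
  have "integral\<^sup>L ?M (\<lambda>s. \<bar>f s\<bar> powr q) \<le> integral\<^sup>L ?M h"
    by (intro integral_mono fi h) (use fh in auto)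
  also have "\<dots> = (1 / 2) powr q / x * (2 * x)"
  proof -
    have "{0<..<2 * x} \<inter> space ?M = {0<..<2 * x}" using sub by auto
    then show ?thesis unfolding h_def
      by (simp only: integral_mult_right_zero Bochner_Integration.integral_indicator meas)
  qed
  also have "\<dots> = 2 * (1 / 2) powr q" using x by simp
  also have "\<dots> \<le> 2 * (1 / 2) powr 1" using q by (intro mult_left_mono powr_mono') auto
  finally have "integral\<^sup>L ?M (\<lambda>s. \<bar>f s\<bar> powr q) \<le> 1" by simp
  then have "integral\<^sup>L ?M (\<lambda>s. \<bar>f s\<bar> powr q) powr (1 / q) \<le> 1"
    using q by (intro powr_le1) auto
  then show ?thesis using f fi False by (simp add: Lp_space_def Lp_norm_def q_def)
qed

lemma DERIV_max_0_square:
  "((\<lambda>y::real. (max 0 y)\<^sup>2) has_real_derivative 2 * max 0 y) (at y)"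
proof -
  consider "y < 0" | "y = 0" | "0 < y" by linarith
  then show ?thesis
  proof cases
    case 1
    then have "eventually (\<lambda>y. y \<in> {..<0}) (nhds y)" by (intro eventually_nhds_in_open) auto
    then have "eventually (\<lambda>y. (max 0 y)\<^sup>2 = 0) (nhds y)" by eventually_elim auto
    then have "((\<lambda>y::real. (max 0 y)\<^sup>2) has_real_derivative 0) (at y) \<longleftrightarrow> ((\<lambda>_. 0) has_real_derivative 0) (at y)"
      by (intro DERIV_cong_ev) auto
    then show ?thesis using 1 by simp
  next
    case 2
    have "((\<lambda>h::real. max 0 h) \<longlongrightarrow> max 0 0) (at 0)" by (intro tendsto_intros)
    moreover have "eventually (\<lambda>h::real. max 0 h = ((max 0 (0 + h))\<^sup>2 - (max 0 0)\<^sup>2) / h) (at 0)"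
      by (auto simp: eventually_at_filter max_def power2_eq_square)
    ultimately have "((\<lambda>h::real. ((max 0 (0 + h))\<^sup>2 - (max 0 0)\<^sup>2) / h) \<longlongrightarrow> max 0 0) (at 0)"
      by (rule Lim_transform_eventually)
    then show ?thesis using 2 by (simp add: DERIV_def)
  next
    case 3
    then have "eventually (\<lambda>y. y \<in> {0<..}) (nhds y)" by (intro eventually_nhds_in_open) auto
    then have "eventually (\<lambda>y. (max 0 y)\<^sup>2 = y\<^sup>2) (nhds y)" by eventually_elim auto
    then have "((\<lambda>y::real. (max 0 y)\<^sup>2) has_real_derivative 2 * y) (at y) \<longleftrightarrow> ((\<lambda>y. y\<^sup>2) has_real_derivative 2 * y) (at y)"
      by (intro DERIV_cong_ev) auto
    moreover have "((\<lambda>y. y\<^sup>2) has_real_derivative 2 * y) (at y)"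
      by (auto intro!: derivative_eq_intros)
    ultimately show ?thesis using 3 by simp
  qed
qed

text \<open>The solution is prescribed through its flux, the rescaled bump
\<open>z s = c * x powr (1 - r) * Z (s / x)\<close> with \<open>Z t = t * (max 0 (2 - t))\<^sup>2\<close> and
\<open>Z 1 = 1\<close>; the datum is whatever \<open>f = u - z'\<close> turns out to be. Both \<open>z'\<close> and \<open>u\<close>
live on \<open>{0..2 * x}\<close> and are of size \<open>x powr (- r)\<close>, the latter because
\<open>s powr (1 - 2 * \<alpha>)\<close> is integrable at 0.\<close>

lemma neumann_solution_with_large_derivative:
  assumes "\<alpha> < 1" and p: "1 \<le> p"
  defines "r \<equiv> real_of_ereal (1 / p)"
  obtains c where "0 < c"
    "\<And>x. 0 < x \<Longrightarrow> x \<le> 1 / 2 \<Longrightarrow>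
      \<exists>f u. f \<in> Lp_space p {0<..<1} \<and> Lp_norm p {0<..<1} f \<le> 1 \<and> neumann_solution \<alpha> p f u \<and>
        \<bar>deriv u x\<bar> = c * x powr (- 2 * \<alpha>) * x powr (1 - r)"
proof -
  define \<beta> where "\<beta> = 2 - 2 * \<alpha>"
  have "0 < \<beta>" using assms by (simp add: \<beta>_def)
  \<comment> \<open>Per unit of \<open>a\<close> below, \<open>z'\<close> is bounded by 12 and \<open>u\<close> by \<open>4 / \<beta>\<close>, so this \<open>c\<close>
    places \<open>f\<close> in the unit ball.\<close>
  define c where "c = 1 / (2 * (12 + 4 / \<beta>))"
  have c: "0 < c" using \<open>0 < \<beta>\<close> by (auto simp: c_def intro!: divide_pos_pos add_pos_pos)
  have c_eq: "c * (12 + 4 / \<beta>) = 1 / 2"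
  proof -
    have "12 + 4 / \<beta> > 0" using \<open>0 < \<beta>\<close> by (intro add_pos_pos) auto
    then show ?thesis by (simp add: c_def)
  qed
  moreover have "\<exists>f u. f \<in> Lp_space p {0<..<1} \<and> Lp_norm p {0<..<1} f \<le> 1 \<and> neumann_solution \<alpha> p f u \<and>
        \<bar>deriv u x\<bar> = c * x powr (- 2 * \<alpha>) * x powr (1 - r)"
    if x: "0 < x" "x \<le> 1 / 2" for x
  proof -
    define a where "a = c * x powr (- r)"
    have a: "0 < a" using c x by (simp add: a_def)
    define m where "m s = max 0 (2 - s / x)" for s
    define z where "z s = a * (s * (m s)\<^sup>2)" for s
    define z' where "z' s = a * ((m s)\<^sup>2 - 2 * (s / x) * m s)" for s
    have dz: "(z has_real_derivative z' s) (at s)" for s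
    proof -
      have m2: "((\<lambda>s. (m s)\<^sup>2) has_real_derivative 2 * m s * (- 1 / x)) (at s)"
        unfolding m_def using x
        by (intro DERIV_chain2[OF DERIV_max_0_square]) (auto intro!: derivative_eq_intros)
      have "(z has_real_derivative a * (1 * (m s)\<^sup>2 + 2 * m s * (- 1 / x) * s)) (at s)"
        unfolding z_def by (intro DERIV_cmult DERIV_mult DERIV_ident m2)
      then show ?thesis by (simp add: z'_def algebra_simps)
    qed
    have contm: "continuous_on A m" for A unfolding m_def by (intro continuous_intros) (use x in auto)
    have contz: "continuous_on A z" and contz': "continuous_on A z'" for A
      unfolding z_def z'_def by (intro continuous_intros contm; use x in auto)+
    have m0: "m s = 0" if "2 * x \<le> s" for s using that x by (simp add: m_def field_simps)
    have m2: "0 \<le> m s" "m s \<le> 2" if "0 \<le> s" for s using that x by (auto simp: m_def)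
    have z_le: "0 \<le> z s" "z s \<le> 4 * a * s" if "0 \<le> s" for s
    proof -
      show "0 \<le> z s" using that a by (simp add: z_def)
      have "(m s)\<^sup>2 \<le> 2\<^sup>2" using m2[OF that] by (intro power_mono) auto
      then have "a * (s * (m s)\<^sup>2) \<le> a * (s * 4)" using that a by (intro mult_left_mono) auto
      then show "z s \<le> 4 * a * s" by (simp add: z_def)
    qed
    define k where "k s = s powr (- 2 * \<alpha>) * z s" for s
    have contk: "continuous_on {0<..1} k" unfolding k_def by (intro continuous_intros contz) auto
    define u where "u s = - integral {s..1} k" for s
    define f where "f s = u s - z' s" for s
    have primu: "primitive_on {0<..1} u k"
    proof -
      have "primitive_on {0<..1} (\<lambda>s. integral {s..1} k) (\<lambda>s. - k s)"
        by (intro primitive_on_integral_to_1 absolutely_integrable_continuous_real continuous_on_subset[OF contk]) auto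
      from primitive_on_cmult[OF this, of "- 1"] show ?thesis by (simp add: u_def[abs_def])
    qed
    have contu: "continuous_on {0<..1} u" by (rule primitive_on_half_open_continuous[OF primu])
    have "primitive_on {0<..1} z z'"
      by (intro primitive_on_if_has_derivative has_field_derivative_at_within[OF dz] contz' is_interval_oc)
    then have primz: "primitive_on {0<..1} z (\<lambda>s. u s - f s)" by (simp add: f_def)
    have u0: "u s = 0" if "2 * x \<le> s" for s
    proof -
      have "integral {s..1} k = integral {s..1} (\<lambda>_. 0)"
        by (intro Henstock_Kurzweil_Integration.integral_cong) (use that in \<open>simp add: k_def z_def m0\<close>)
      then show ?thesis by (simp add: u_def)
    qed
    have u_le: "\<bar>u s\<bar> \<le> 4 * a / \<beta>" if s: "s \<in> {0<..1}" for s
    proof -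
      have kint: "k integrable_on {s..1}"
        using s by (intro integrable_continuous_real continuous_on_subset[OF contk]) auto
      have "((\<lambda>t. 4 * a * t powr (\<beta> - 1)) has_integral (4 * a * 1 powr \<beta> / \<beta> - 4 * a * s powr \<beta> / \<beta>)) {s..1}"
      proof (rule fundamental_theorem_of_calculus)
        fix t assume t: "t \<in> {s..1}"
        have "((\<lambda>t. 4 * a * t powr \<beta> / \<beta>) has_real_derivative 4 * a * t powr (\<beta> - 1)) (at t within {s..1})"
          using t s \<open>0 < \<beta>\<close> by (auto intro!: derivative_eq_intros)
        then show "((\<lambda>t. 4 * a * t powr \<beta> / \<beta>) has_vector_derivative 4 * a * t powr (\<beta> - 1)) (at t within {s..1})"
          by (simp add: has_real_derivative_iff_has_vector_derivative)
      qed (use s in simp)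
      note int = this
      have "k t \<le> 4 * a * t powr (\<beta> - 1)" if t: "t \<in> {s..1}" for t
      proof -
        have "k t \<le> t powr (- 2 * \<alpha>) * (4 * a * t)"
          unfolding k_def using t s by (intro mult_left_mono z_le) auto
        also have "\<dots> = 4 * a * (t powr (- 2 * \<alpha>) * t powr 1)" using t s by simp
        also have "t powr (- 2 * \<alpha>) * t powr 1 = t powr (\<beta> - 1)"
          by (simp only: powr_add[symmetric] \<beta>_def) (simp add: algebra_simps)
        finally show ?thesis .
      qed
      then have "integral {s..1} k \<le> 4 * a * 1 powr \<beta> / \<beta> - 4 * a * s powr \<beta> / \<beta>"
        by (intro has_integral_le[OF integrable_integral[OF kint] int]) auto
      moreover have "0 \<le> 4 * a * s powr \<beta> / \<beta>" using a \<open>0 < \<beta>\<close> by simp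
      ultimately have "integral {s..1} k \<le> 4 * a / \<beta>" by simp
      moreover have "0 \<le> integral {s..1} k"
        using s by (intro integral_nonneg kint) (auto simp: k_def intro!: mult_nonneg_nonneg z_le)
      ultimately show ?thesis by (simp add: u_def)
    qed
    have z'_le: "\<bar>z' s\<bar> \<le> 12 * a" if s: "s \<in> {0<..<2 * x}" for s
    proof -
      have sx: "0 \<le> s / x" "s / x \<le> 2" using s x by (auto simp: field_simps)
      have "(m s)\<^sup>2 \<le> 2\<^sup>2" using m2[of s] s by (intro power_mono) auto
      then have "(m s)\<^sup>2 \<le> 4" by simp
      moreover have "(s / x) * m s \<le> 2 * 2" using sx m2[of s] s by (intro mult_mono) auto
      moreover have "0 \<le> (s / x) * m s" "0 \<le> (m s)\<^sup>2" using sx m2[of s] s by auto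
      ultimately have "\<bar>(m s)\<^sup>2 - 2 * ((s / x) * m s)\<bar> \<le> 12" by linarith
      then have "\<bar>(m s)\<^sup>2 - 2 * (s / x) * m s\<bar> \<le> 12" by (simp only: mult.assoc)
      then have "a * \<bar>(m s)\<^sup>2 - 2 * (s / x) * m s\<bar> \<le> a * 12" using a by (intro mult_left_mono) auto
      then show ?thesis using a by (simp add: z'_def abs_mult)
    qed
    have "f \<in> Lp_space p {0<..<1} \<and> Lp_norm p {0<..<1} f \<le> 1"
    proof (rule Lp_unit_ball_if_concentrated[OF p x])
      show "f \<in> borel_measurable (lebesgue_on {0<..<1})"
        unfolding f_def
        by (intro continuous_imp_measurable_on_sets_lebesgue continuous_intros contz' continuous_on_subset[OF contu]) auto
      show "f s = 0" if "s \<in> {2 * x..<1}" for s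
        using that by (simp add: f_def u0 z'_def m0)
      show "\<bar>f s\<bar> \<le> x powr (- real_of_ereal (1 / p)) / 2" if s: "s \<in> {0<..<2 * x}" for s
      proof -
        have "\<bar>f s\<bar> \<le> 4 * a / \<beta> + 12 * a"
          unfolding f_def using u_le[of s] z'_le[OF s] s x by auto
        also have "\<dots> = c * (12 + 4 / \<beta>) * x powr (- r)" by (simp add: a_def algebra_simps)
        finally show ?thesis unfolding c_eq r_def by simp
      qed
    qed
    then have f: "f \<in> Lp_space p {0<..<1}" "Lp_norm p {0<..<1} f \<le> 1" by auto
    have "isCont z 0" by (rule DERIV_isCont[OF dz])
    then have "(z \<longlongrightarrow> z 0) (at_right 0)" unfolding isCont_def by (rule tendsto_within_subset) auto
    then have lim: "(z \<longlongrightarrow> 0) (at_right 0)" by (simp add: z_def)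
    have u1: "u 1 = 0" using x by (intro u0) simp
    note sol = neumann_solutionI[OF f(1) p contu contz primu[unfolded k_def] primz u1 lim]
    have "\<bar>deriv (restrict u {0<..1}) x\<bar> = x powr (- 2 * \<alpha>) * z x"
      using sol(2)[of x] z_le(1)[of x] x by (simp add: abs_mult)
    also have "z x = c * (x powr (- r) * x powr 1)" using x by (simp add: z_def m_def a_def)
    also have "x powr (- r) * x powr 1 = x powr (1 - r)"
      by (simp only: powr_add[symmetric]) (simp add: add.commute)
    finally have "\<bar>deriv (restrict u {0<..1}) x\<bar> = c * x powr (- 2 * \<alpha>) * x powr (1 - r)"
      by (simp only: mult_ac)
    then show ?thesis using f sol(1) by blast
  qed
  ultimately show ?thesis using that c by blast
qed

theorem mainTheorem4:
  fixes \<alpha> :: real and p :: ereal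
  assumes "\<alpha> < 1" and "1 \<le> p"
  shows "\<exists>\<epsilon>\<^sub>0 C\<^sub>1 C\<^sub>2 :: real. 0 < \<epsilon>\<^sub>0 \<and> \<epsilon>\<^sub>0 < 1 \<and> 0 < C\<^sub>1 \<and> C\<^sub>1 < C\<^sub>2 \<and>
    (\<forall>x. 0 < x \<and> x \<le> \<epsilon>\<^sub>0 \<longrightarrow> ereal C\<^sub>1 \<le> K_N \<alpha> p x \<and> K_N \<alpha> p x \<le> ereal C\<^sub>2)"
proof -
  define r where "r = real_of_ereal (1 / p)"
  obtain K where K: "0 < K" "\<And>f. f \<in> Lp_space p {0<..<1} \<Longrightarrow> Lp_norm p {0<..<1} f \<le> 1 \<Longrightarrow>
      \<exists>u. neumann_solution \<alpha> p f u \<and>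
        (\<forall>x\<in>{0<..<1}. \<bar>deriv u x\<bar> \<le> K * x powr (- 2 * \<alpha>) * x powr (1 - r))"
    using neumann_solution_exists_bounded[OF assms, folded r_def] by blast
  obtain c where c: "0 < c" "\<And>x. 0 < x \<Longrightarrow> x \<le> 1 / 2 \<Longrightarrow>
      \<exists>f u. f \<in> Lp_space p {0<..<1} \<and> Lp_norm p {0<..<1} f \<le> 1 \<and> neumann_solution \<alpha> p f u \<and>
        \<bar>deriv u x\<bar> = c * x powr (- 2 * \<alpha>) * x powr (1 - r)"
    using neumann_solution_with_large_derivative[OF assms, folded r_def] by blast
  have cancel: "x powr (2 * \<alpha> - 1 + r) * (b * x powr (- 2 * \<alpha>) * x powr (1 - r)) = b" if "0 < x" for x b :: real
  proof -
    have "x powr (2 * \<alpha> - 1 + r) * (b * x powr (- 2 * \<alpha>) * x powr (1 - r))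
        = b * (x powr (2 * \<alpha> - 1 + r) * x powr (- 2 * \<alpha>) * x powr (1 - r))" by (simp only: mult_ac)
    also have "\<dots> = b * x powr ((2 * \<alpha> - 1 + r) + (- 2 * \<alpha>) + (1 - r))" by (simp only: powr_add)
    also have "\<dots> = b" using that by simp
    finally show ?thesis .
  qed
  have "ereal c \<le> K_N \<alpha> p x \<and> K_N \<alpha> p x \<le> ereal (c + K)" if x: "0 < x" "x \<le> 1 / 2" for x
  proof
    obtain f u where f: "f \<in> Lp_space p {0<..<1}" "Lp_norm p {0<..<1} f \<le> 1" "neumann_solution \<alpha> p f u"
      and du: "\<bar>deriv u x\<bar> = c * x powr (- 2 * \<alpha>) * x powr (1 - r)"
      using c(2)[OF x] by blast
    have "\<bar>x powr (2 * \<alpha> - 1 + r) * deriv (u_N \<alpha> p f) x\<bar> = c"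
      using cancel[OF x(1), of c] by (simp add: u_N_eq[OF f(3)] abs_mult du)
    then show "ereal c \<le> K_N \<alpha> p x"
      unfolding K_N_def r_def[symmetric] using f by (intro SUP_upper2[of f]) auto
    show "K_N \<alpha> p x \<le> ereal (c + K)"
      unfolding K_N_def r_def[symmetric]
    proof (rule SUP_least)
      fix g assume "g \<in> {f \<in> Lp_space p {0<..<1}. Lp_norm p {0<..<1} f \<le> 1}"
      then obtain w where w: "neumann_solution \<alpha> p g w"
        and dw: "\<bar>deriv w x\<bar> \<le> K * x powr (- 2 * \<alpha>) * x powr (1 - r)"
        using K(2)[of g] x by auto
      have "\<bar>x powr (2 * \<alpha> - 1 + r) * deriv (u_N \<alpha> p g) x\<bar>
          \<le> x powr (2 * \<alpha> - 1 + r) * (K * x powr (- 2 * \<alpha>) * x powr (1 - r))"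
        unfolding u_N_eq[OF w] abs_mult using dw by (simp add: mult_left_mono)
      also have "\<dots> \<le> c + K" unfolding cancel[OF x(1)] using c(1) by simp
      finally show "ereal \<bar>x powr (2 * \<alpha> - 1 + r) * deriv (u_N \<alpha> p g) x\<bar> \<le> ereal (c + K)" by simp
    qed
  qed
  then show ?thesis
    using c(1) K(1) by (intro exI[of _ "1 / 2"] exI[of _ c] exI[of _ "c + K"]) auto
qed

end
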